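(* Let $(\bar{M},\bar{g},\bar{\nabla},\bar{\nabla}^{*})$ be an indefinite statistical manifold and let $(M,g)$ be a lightlike submanifold of $\bar M$ with induced connections $\nabla$ and $\nabla^{*}$. If $h^{l}$ and $h^{*l}$ vanish identically, then $(M,g,\nabla)$ and $(M,g,\nabla^{*})$ are lightlike statistical submanifolds of $\bar{M}$, and $\nabla^{*}$ is a dual connection of $\nabla$ with respect to the induced metric $g$.
   Context: All objects are smooth; $\Gamma(E)$ denotes sections of $E$. An indefinite statistical manifold $(\bar M,\bar g,\bar\nabla,\bar\nabla^* )$ is an $(m+n)$-dimensional manifold ($m,n\ge 1$) with a semi-Riemannian metric $\bar g$ of constant index $q$, $1\le q\le m+n-1$, a torsion-free affine connection $\bar\nabla$ with $(\bar\nabla_X\bar g)(Y,Z)=(\bar\nabla_Y\bar g)(X,Z)$, and its torsion-free dual connection $\bar\nabla^*$, determined by $X\bar g(Y,Z)=\bar g(\bar\nabla_XY,Z)+\bar g(Y,\bar\nabla^*_XZ)$, for all vector fields $X,Y,Z$ on $\bar M$. A lightlike submanifold $(M,g)$ is an $m$-dimensional submanifold with degenerate induced (symmetric bilinear) metric $g$ such that $Rad(TM)=TM\cap TM^\perp$ is a smooth distribution of rank $r>0$. Fix a screen distribution $S(TM)$, a non-degenerate complement with $TM=Rad(TM)\perp S(TM)$; a non-degenerate complement $S(TM^\perp)$ of $Rad(TM)$ in $TM^\perp$; and a lightlike transversal bundle $ltr(TM)$ of rank $r$, having local frames $\{N_i\}$ with $\bar g(N_i,\xi_j)=\delta_{ij}$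 for a local frame $\{\xi_j\}$ of $Rad(TM)$, $\bar g(N_i,N_j)=0$, and $ltr(TM)$ orthogonal to $S(TM)$ and $S(TM^\perp)$. Put $tr(TM)=ltr(TM)\perp S(TM^\perp)$, so $T\bar M|_M=TM\oplus tr(TM)$. For $X,Y\in\Gamma(TM)$ decompose $\bar\nabla_XY=\nabla_XY+h^l(X,Y)+h^s(X,Y)$ and $\bar\nabla^*_XY=\nabla^*_XY+h^{*l}(X,Y)+h^{*s}(X,Y)$, with $\nabla_XY,\nabla^*_XY\in\Gamma(TM)$, $h^l,h^{*l}$ valued in $ltr(TM)$, and $h^s,h^{*s}$ valued in $S(TM^\perp)$. The induced connections $\nabla,\nabla^*$ are torsion-free. $(M,g,\nabla)$ is a lightlike statistical submanifold if $(\nabla_Xg)(Y,Z)=(\nabla_Yg)(X,Z)$ for all $X,Y,Z\in\Gamma(TM)$; similarly for $(M,g,\nabla^* )$ with $\nabla^*$ in place of $\nabla$. $\nabla^*$ is a dual connection of $\nabla$ with respect to $g$ if $Xg(Y,Z)=g(\nabla_XY,Z)+g(Y,\nabla^*_XZ)$ for all $X,Y,Z\in\Gamma(TM)$. *)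

theory Defs
  imports "HOL-Analysis.Analysis" "HOL-Library.Function_Algebras"
begin

instantiation "fun" :: (type, scaleR) scaleR
begin
definition scaleR_fun :: "real \<Rightarrow> ('a \<Rightarrow> 'b) \<Rightarrow> 'a \<Rightarrow> 'b"
  where "scaleR_fun c f = (\<lambda>x. c *\<^sub>R f x)"
instance ..
end

instance "fun" :: (type, real_vector) real_vector
  by standard (auto simp: scaleR_fun_def plus_fun_def fun_eq_iff scaleR_add_right scaleR_add_left)

section \<open>Smooth manifolds\<close>

text \<open>To be used on open sets \<open>S\<close> only.\<close>

primrec Ck_on :: "nat \<Rightarrow> 'e::euclidean_space set \<Rightarrow> ('e \<Rightarrow> 'f::real_normed_vector) \<Rightarrow> bool" where
  "Ck_on 0 S f \<longleftrightarrow> continuous_on S f"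
| "Ck_on (Suc k) S f \<longleftrightarrow> (\<forall>x\<in>S. f differentiable (at x)) \<and>
     (\<forall>v. Ck_on k S (\<lambda>x. frechet_derivative f (at x) v))"

definition smooth_on :: "'e::euclidean_space set \<Rightarrow> ('e \<Rightarrow> 'f::real_normed_vector) \<Rightarrow> bool" where
  "smooth_on S f \<longleftrightarrow> (\<forall>k. Ck_on k S f)"

type_synonym ('a, 'e) chart = "'a set \<times> ('a \<Rightarrow> 'e)"

definition chart_inv :: "('a, 'e) chart \<Rightarrow> 'e \<Rightarrow> 'a" where
  "chart_inv c = the_inv_into (fst c) (snd c)"

text \<open>The dimension of the manifold is the dimension of the model space \<open>'e\<close>. The atlas need not
  be maximal.\<close>

datatype ('a, 'e) mfd = Mfd (mtop: "'a topology") (atlas: "('a, 'e) chart set")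

abbreviation points :: "('a, 'e) mfd \<Rightarrow> 'a set" where
  "points M \<equiv> topspace (mtop M)"

definition second_countable_top :: "'a topology \<Rightarrow> bool" where
  "second_countable_top T \<longleftrightarrow> (\<exists>B. countable B \<and> (\<forall>V\<in>B. openin T V) \<and>
     (\<forall>U p. openin T U \<and> p \<in> U \<longrightarrow> (\<exists>V\<in>B. p \<in> V \<and> V \<subseteq> U)))"

definition smooth_manifold :: "('a, 'e::euclidean_space) mfd \<Rightarrow> bool" where
  "smooth_manifold M \<longleftrightarrow>
     Hausdorff_space (mtop M) \<and> second_countable_top (mtop M) \<and>
     (\<forall>(U, \<phi>)\<in>atlas M. openin (mtop M) U \<and> open (\<phi> ` U) \<and>
        homeomorphic_map (subtopology (mtop M) U) (top_of_set (\<phi> ` U)) \<phi>) \<and>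
     (\<Union>c\<in>atlas M. fst c) = points M \<and>
     (\<forall>c\<in>atlas M. \<forall>d\<in>atlas M. smooth_on (snd c ` (fst c \<inter> fst d)) (snd d \<circ> chart_inv c))"

text \<open>For \<open>U\<close> open in \<open>M\<close>.\<close>

definition smooth_fun_on :: "('a, 'e::euclidean_space) mfd \<Rightarrow> 'a set \<Rightarrow> ('a \<Rightarrow> real) \<Rightarrow> bool" where
  "smooth_fun_on M U f \<longleftrightarrow> (\<forall>c\<in>atlas M. smooth_on (snd c ` (U \<inter> fst c)) (f \<circ> chart_inv c))"

definition Csmooth :: "('a, 'e::euclidean_space) mfd \<Rightarrow> ('a \<Rightarrow> real) set" where
  "Csmooth M = {f. smooth_fun_on M (points M) f}"

text \<open>A tangent vector at \<open>p\<close> is a directional derivative operator at \<open>p\<close> in some (equivalently, any)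
  chart. It acts on \<open>Csmooth M\<close> and is set to \<open>0\<close> on all other functions, so that equality and the
  vector space operations are those of the function space.\<close>

type_synonym 'a tangent = "('a \<Rightarrow> real) \<Rightarrow> real"
type_synonym 'a field = "'a \<Rightarrow> 'a tangent"

definition tangent_space :: "('a, 'e::euclidean_space) mfd \<Rightarrow> 'a \<Rightarrow> 'a tangent set" where
  "tangent_space M p =
     {\<lambda>f. if f \<in> Csmooth M then frechet_derivative (f \<circ> chart_inv c) (at (snd c p)) u else 0 | c u.
        c \<in> atlas M \<and> p \<in> fst c}"

text \<open>Smooth sections, over an open subset \<open>U\<close> of \<open>M\<close>, of the pullback to \<open>M\<close> of the tangent bundle
  of \<open>N\<close>, where \<open>M\<close> is a submanifold of \<open>N\<close> (possibly \<open>M = N\<close>).\<close>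

definition smooth_along ::
  "('a, 'e::euclidean_space) mfd \<Rightarrow> ('a, 'm::euclidean_space) mfd \<Rightarrow> 'a set \<Rightarrow> 'a field \<Rightarrow> bool" where
  "smooth_along N M U W \<longleftrightarrow> (\<forall>q\<in>U. W q \<in> tangent_space N q) \<and>
     (\<forall>f\<in>Csmooth N. smooth_fun_on M U (\<lambda>q. W q f))"

text \<open>Vector fields are extended by \<open>0\<close> outside the manifold, so that equality of fields is equality
  on the manifold.\<close>

definition vector_fields :: "('a, 'e::euclidean_space) mfd \<Rightarrow> 'a field set" where
  "vector_fields M = {X. smooth_along M M (points M) X \<and> (\<forall>p. p \<notin> points M \<longrightarrow> X p = 0)}"

definition scale_field :: "('a \<Rightarrow> real) \<Rightarrow> 'a field \<Rightarrow> 'a field" where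
  "scale_field f X = (\<lambda>p. f p *\<^sub>R X p)"

definition field_app :: "'a field \<Rightarrow> ('a \<Rightarrow> real) \<Rightarrow> 'a \<Rightarrow> real" where
  "field_app X f = (\<lambda>p. X p f)"

definition lie_bracket :: "'a field \<Rightarrow> 'a field \<Rightarrow> 'a field" where
  "lie_bracket X Y = (\<lambda>p f. X p (field_app Y f) - Y p (field_app X f))"

section \<open>Metrics and connections\<close>

type_synonym 'a metric_field = "'a \<Rightarrow> 'a tangent \<Rightarrow> 'a tangent \<Rightarrow> real"
type_synonym 'a connection = "'a field \<Rightarrow> 'a field \<Rightarrow> 'a field"

definition pairing :: "'a metric_field \<Rightarrow> 'a field \<Rightarrow> 'a field \<Rightarrow> 'a \<Rightarrow> real" where
  "pairing g X Y = (\<lambda>p. g p (X p) (Y p))"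

definition symmetric_bilinear_on ::
  "'v::real_vector set \<Rightarrow> ('v \<Rightarrow> 'v \<Rightarrow> real) \<Rightarrow> bool" where
  "symmetric_bilinear_on V B \<longleftrightarrow>
     (\<forall>u\<in>V. \<forall>v\<in>V. B u v = B v u) \<and>
     (\<forall>u\<in>V. \<forall>v\<in>V. \<forall>w\<in>V. \<forall>a b. B (a *\<^sub>R u + b *\<^sub>R v) w = a * B u w + b * B v w)"

definition nondegenerate_on :: "'v::real_vector set \<Rightarrow> ('v \<Rightarrow> 'v \<Rightarrow> real) \<Rightarrow> bool" where
  "nondegenerate_on V B \<longleftrightarrow> (\<forall>v\<in>V. (\<forall>w\<in>V. B v w = 0) \<longrightarrow> v = 0)"

definition form_index :: "'v::real_vector set \<Rightarrow> ('v \<Rightarrow> 'v \<Rightarrow> real) \<Rightarrow> nat" where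
  "form_index V B = Max {dim W | W. subspace W \<and> W \<subseteq> V \<and> (\<forall>v\<in>W. v \<noteq> 0 \<longrightarrow> B v v < 0)}"

definition semi_riemannian_metric ::
  "('a, 'e::euclidean_space) mfd \<Rightarrow> nat \<Rightarrow> 'a metric_field \<Rightarrow> bool" where
  "semi_riemannian_metric M q g \<longleftrightarrow>
     (\<forall>p\<in>points M. symmetric_bilinear_on (tangent_space M p) (g p) \<and>
        nondegenerate_on (tangent_space M p) (g p) \<and> form_index (tangent_space M p) (g p) = q) \<and>
     (\<forall>X\<in>vector_fields M. \<forall>Y\<in>vector_fields M. pairing g X Y \<in> Csmooth M)"

text \<open>\<open>D X Y\<close> is the covariant derivative of \<open>Y\<close> in direction \<open>X\<close>.\<close>

definition affine_connection ::
  "('a, 'e::euclidean_space) mfd \<Rightarrow> 'a connection \<Rightarrow> bool" where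
  "affine_connection M D \<longleftrightarrow>
     (\<forall>X\<in>vector_fields M. \<forall>Y\<in>vector_fields M. D X Y \<in> vector_fields M) \<and>
     (\<forall>X\<in>vector_fields M. \<forall>Y\<in>vector_fields M. \<forall>Z\<in>vector_fields M.
        D (X + Y) Z = D X Z + D Y Z \<and> D X (Y + Z) = D X Y + D X Z) \<and>
     (\<forall>X\<in>vector_fields M. \<forall>Y\<in>vector_fields M. \<forall>f\<in>Csmooth M.
        D (scale_field f X) Y = scale_field f (D X Y) \<and>
        D X (scale_field f Y) = scale_field (field_app X f) Y + scale_field f (D X Y))"

definition torsion_free :: "('a, 'e::euclidean_space) mfd \<Rightarrow> 'a connection \<Rightarrow> bool" where
  "torsion_free M D \<longleftrightarrow>
     (\<forall>X\<in>vector_fields M. \<forall>Y\<in>vector_fields M. D X Y - D Y X = lie_bracket X Y)"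

text \<open>\<open>metric_deriv g D X Y Z\<close> is the function \<open>(D\<^sub>X g)(Y, Z)\<close>.\<close>

definition metric_deriv ::
  "'a metric_field \<Rightarrow> 'a connection \<Rightarrow> 'a field \<Rightarrow> 'a field \<Rightarrow> 'a field \<Rightarrow> 'a \<Rightarrow> real" where
  "metric_deriv g D X Y Z =
     (\<lambda>p. field_app X (pairing g Y Z) p - pairing g (D X Y) Z p - pairing g Y (D X Z) p)"

definition codazzi ::
  "('a, 'e::euclidean_space) mfd \<Rightarrow> 'a metric_field \<Rightarrow> 'a connection \<Rightarrow> bool" where
  "codazzi M g D \<longleftrightarrow>
     (\<forall>X\<in>vector_fields M. \<forall>Y\<in>vector_fields M. \<forall>Z\<in>vector_fields M. \<forall>p\<in>points M.
        metric_deriv g D X Y Z p = metric_deriv g D Y X Z p)"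

definition dual_connection ::
  "('a, 'e::euclidean_space) mfd \<Rightarrow> 'a metric_field \<Rightarrow> 'a connection \<Rightarrow> 'a connection \<Rightarrow> bool" where
  "dual_connection M g D D' \<longleftrightarrow>
     (\<forall>X\<in>vector_fields M. \<forall>Y\<in>vector_fields M. \<forall>Z\<in>vector_fields M. \<forall>p\<in>points M.
        field_app X (pairing g Y Z) p = pairing g (D X Y) Z p + pairing g Y (D' X Z) p)"

definition indefinite_statistical_manifold ::
  "('a, 'e::euclidean_space) mfd \<Rightarrow> nat \<Rightarrow> 'a metric_field \<Rightarrow> 'a connection \<Rightarrow> 'a connection \<Rightarrow> bool"
where
  "indefinite_statistical_manifold N q g D D' \<longleftrightarrow>
     smooth_manifold N \<and> 1 \<le> q \<and> q \<le> DIM('e) - 1 \<and> semi_riemannian_metric N q g \<and>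
     affine_connection N D \<and> torsion_free N D \<and> codazzi N g D \<and>
     affine_connection N D' \<and> torsion_free N D' \<and> dual_connection N g D D'"

section \<open>Lightlike submanifolds\<close>

text \<open>Injectively immersed submanifolds of positive codimension: \<open>M\<close> may carry a finer topology than
  the one induced from \<open>N\<close>. Embedded submanifolds are the case where \<open>mtop M\<close> is the subspace
  topology.\<close>

definition submanifold ::
  "('a, 'e::euclidean_space) mfd \<Rightarrow> ('a, 'm::euclidean_space) mfd \<Rightarrow> bool" where
  "submanifold N M \<longleftrightarrow> smooth_manifold M \<and> DIM('m) < DIM('e) \<and>
     points M \<subseteq> points N \<and> continuous_map (mtop M) (mtop N) (\<lambda>p. p) \<and>
     (\<forall>c\<in>atlas M. \<forall>d\<in>atlas N.
        smooth_on (snd c ` (fst c \<inter> fst d)) (snd d \<circ> chart_inv c) \<and>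
        (\<forall>p\<in>fst c \<inter> fst d. inj (frechet_derivative (snd d \<circ> chart_inv c) (at (snd c p)))))"

text \<open>The differential of the inclusion of a submanifold into \<open>N\<close>: the pullback of \<open>f\<close> under the
  inclusion is \<open>f\<close> itself, as a function on the points of the submanifold.\<close>

definition push :: "('a, 'e::euclidean_space) mfd \<Rightarrow> 'a tangent \<Rightarrow> 'a tangent" where
  "push N v = (\<lambda>f. if f \<in> Csmooth N then v f else 0)"

definition tangent_in ::
  "('a, 'e::euclidean_space) mfd \<Rightarrow> ('a, 'm::euclidean_space) mfd \<Rightarrow> 'a \<Rightarrow> 'a tangent set" where
  "tangent_in N M p = push N ` tangent_space M p"

definition normal_in ::
  "('a, 'e::euclidean_space) mfd \<Rightarrow> 'a metric_field \<Rightarrow> ('a, 'm::euclidean_space) mfd \<Rightarrow>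
    'a \<Rightarrow> 'a tangent set" where
  "normal_in N g M p = {w \<in> tangent_space N p. \<forall>v\<in>tangent_in N M p. g p v w = 0}"

definition rad ::
  "('a, 'e::euclidean_space) mfd \<Rightarrow> 'a metric_field \<Rightarrow> ('a, 'm::euclidean_space) mfd \<Rightarrow>
    'a \<Rightarrow> 'a tangent set" where
  "rad N g M p = tangent_in N M p \<inter> normal_in N g M p"

definition induced_metric ::
  "('a, 'e::euclidean_space) mfd \<Rightarrow> 'a metric_field \<Rightarrow> 'a metric_field" where
  "induced_metric N g = (\<lambda>p v w. g p (push N v) (push N w))"

text \<open>Vector bundles over \<open>M\<close> are given by their fibres, subspaces of the tangent spaces of \<open>N\<close>.\<close>

definition local_frame ::
  "('a, 'e::euclidean_space) mfd \<Rightarrow> ('a, 'm::euclidean_space) mfd \<Rightarrow> nat \<Rightarrow>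
    ('a \<Rightarrow> 'a tangent set) \<Rightarrow> 'a set \<Rightarrow> (nat \<Rightarrow> 'a field) \<Rightarrow> bool" where
  "local_frame N M k E U F \<longleftrightarrow> (\<forall>i<k. smooth_along N M U (F i)) \<and>
     (\<forall>q\<in>U. inj_on (\<lambda>i. F i q) {..<k} \<and> independent ((\<lambda>i. F i q) ` {..<k}) \<and>
        span ((\<lambda>i. F i q) ` {..<k}) = E q)"

definition subbundle ::
  "('a, 'e::euclidean_space) mfd \<Rightarrow> ('a, 'm::euclidean_space) mfd \<Rightarrow> nat \<Rightarrow>
    ('a \<Rightarrow> 'a tangent set) \<Rightarrow> bool" where
  "subbundle N M k E \<longleftrightarrow>
     (\<forall>p\<in>points M. \<exists>U F. openin (mtop M) U \<and> p \<in> U \<and> local_frame N M k E U F)"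

text \<open>The condition \<open>0 < r\<close> says that the induced metric is degenerate.\<close>

definition lightlike_submanifold ::
  "('a, 'e::euclidean_space) mfd \<Rightarrow> 'a metric_field \<Rightarrow> nat \<Rightarrow> ('a, 'm::euclidean_space) mfd \<Rightarrow> bool"
where
  "lightlike_submanifold N g r M \<longleftrightarrow>
     submanifold N M \<and> 0 < r \<and> subbundle N M r (rad N g M)"

definition complementary :: "'v::real_vector set \<Rightarrow> 'v set \<Rightarrow> 'v set \<Rightarrow> bool" where
  "complementary V A B \<longleftrightarrow> A \<inter> B = {0} \<and> {a + b | a b. a \<in> A \<and> b \<in> B} = V"

text \<open>\<open>S\<close> is the screen distribution, of rank \<open>m - r\<close>.\<close>

definition screen_distribution ::
  "('a, 'e::euclidean_space) mfd \<Rightarrow> 'a metric_field \<Rightarrow> nat \<Rightarrow> ('a, 'm::euclidean_space) mfd \<Rightarrow>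
    ('a \<Rightarrow> 'a tangent set) \<Rightarrow> bool" where
  "screen_distribution N g r M S \<longleftrightarrow> subbundle N M (DIM('m) - r) S \<and>
     (\<forall>p\<in>points M. complementary (tangent_in N M p) (rad N g M p) (S p) \<and>
        nondegenerate_on (S p) (g p))"

text \<open>\<open>S'\<close> is the screen transversal bundle, of rank \<open>n - r\<close>, where \<open>n\<close> is the codimension.\<close>

definition screen_transversal_bundle ::
  "('a, 'e::euclidean_space) mfd \<Rightarrow> 'a metric_field \<Rightarrow> nat \<Rightarrow> ('a, 'm::euclidean_space) mfd \<Rightarrow>
    ('a \<Rightarrow> 'a tangent set) \<Rightarrow> bool" where
  "screen_transversal_bundle N g r M S' \<longleftrightarrow> subbundle N M (DIM('e) - DIM('m) - r) S' \<and>
     (\<forall>p\<in>points M. complementary (normal_in N g M p) (rad N g M p) (S' p) \<and>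
        nondegenerate_on (S' p) (g p))"

definition lightlike_transversal_bundle ::
  "('a, 'e::euclidean_space) mfd \<Rightarrow> 'a metric_field \<Rightarrow> nat \<Rightarrow> ('a, 'm::euclidean_space) mfd \<Rightarrow>
    ('a \<Rightarrow> 'a tangent set) \<Rightarrow> ('a \<Rightarrow> 'a tangent set) \<Rightarrow> ('a \<Rightarrow> 'a tangent set) \<Rightarrow> bool" where
  "lightlike_transversal_bundle N g r M S S' L \<longleftrightarrow>
     (\<forall>p\<in>points M. \<exists>U \<xi> F. openin (mtop M) U \<and> p \<in> U \<and>
        local_frame N M r (rad N g M) U \<xi> \<and> local_frame N M r L U F \<and>
        (\<forall>i<r. \<forall>j<r. \<forall>q\<in>U. g q (F i q) (\<xi> j q) = (if i = j then 1 else 0) \<and>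
           g q (F i q) (F j q) = 0)) \<and>
     (\<forall>p\<in>points M. \<forall>v\<in>L p. \<forall>w\<in>S p \<union> S' p. g p v w = 0)"

text \<open>\<open>Z\<close> is a vector field on \<open>N\<close> that extends the vector field \<open>X\<close> on \<open>M\<close> near \<open>p\<close>.\<close>

definition extends_near ::
  "('a, 'e::euclidean_space) mfd \<Rightarrow> ('a, 'm::euclidean_space) mfd \<Rightarrow> 'a \<Rightarrow> 'a field \<Rightarrow> 'a field \<Rightarrow> bool"
where
  "extends_near N M p X Z \<longleftrightarrow> Z \<in> vector_fields N \<and>
     (\<exists>U. openin (mtop M) U \<and> p \<in> U \<and> (\<forall>q\<in>U. Z q = push N (X q)))"

text \<open>The value at \<open>p\<close> of \<open>D\<close> along \<open>M\<close>, applied to \<open>X\<close> and \<open>Y\<close>, is the common value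
  \<open>D X' Y' p\<close> for all local extensions \<open>X'\<close> and \<open>Y'\<close> of \<open>X\<close> and \<open>Y\<close> to \<open>N\<close>. As tangent spaces of
  \<open>N\<close> split into tangent spaces of \<open>M\<close> and the fibres of \<open>L\<close> and \<open>S'\<close>, the connection \<open>D\<close>
  determines the induced connection \<open>C\<close> and the forms \<open>hl\<close> and \<open>hs\<close> on vector fields of \<open>M\<close>.\<close>

definition gauss_decomposition ::
  "('a, 'e::euclidean_space) mfd \<Rightarrow> ('a, 'm::euclidean_space) mfd \<Rightarrow>
    ('a \<Rightarrow> 'a tangent set) \<Rightarrow> ('a \<Rightarrow> 'a tangent set) \<Rightarrow> 'a connection \<Rightarrow>
    'a connection \<Rightarrow> 'a connection \<Rightarrow> 'a connection \<Rightarrow> bool" where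
  "gauss_decomposition N M L S' D C hl hs \<longleftrightarrow>
     (\<forall>X\<in>vector_fields M. \<forall>Y\<in>vector_fields M. C X Y \<in> vector_fields M \<and>
        (\<forall>p\<in>points M. hl X Y p \<in> L p \<and> hs X Y p \<in> S' p \<and>
           (\<forall>X' Y'. extends_near N M p X X' \<and> extends_near N M p Y Y' \<longrightarrow>
              D X' Y' p = push N (C X Y p) + hl X Y p + hs X Y p)))"

definition vanishes_identically :: "('a, 'm::euclidean_space) mfd \<Rightarrow> 'a connection \<Rightarrow> bool" where
  "vanishes_identically M h \<longleftrightarrow>
     (\<forall>X\<in>vector_fields M. \<forall>Y\<in>vector_fields M. \<forall>p\<in>points M. h X Y p = 0)"

definition lightlike_statistical_submanifold ::
  "('a, 'e::euclidean_space) mfd \<Rightarrow> 'a metric_field \<Rightarrow> nat \<Rightarrow> ('a, 'm::euclidean_space) mfd \<Rightarrow>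
    'a connection \<Rightarrow> bool" where
  "lightlike_statistical_submanifold N g r M C \<longleftrightarrow>
     lightlike_submanifold N g r M \<and> codazzi M (induced_metric N g) C"

end

theory Submission
  imports Defs
begin

text \<open>
  For vector fields \<open>X\<close>, \<open>Y\<close>, \<open>Z\<close> on \<open>M\<close>, the Gauss decomposition gives
  \<open>D X Y = C X Y + hl X Y + hs X Y\<close>. The field \<open>hs X Y\<close> is normal to \<open>M\<close>, so if \<open>hl\<close> vanishes, then
  \<open>g (D X Y) Z = g (C X Y) Z\<close> for tangential \<open>Z\<close> (\<open>metric_tangential_part\<close>), and likewise for \<open>D'\<close>.
  Therefore the identities that define duality and the Codazzi condition on \<open>N\<close>, applied to tangential
  fields, become the same identities for \<open>C\<close>, \<open>C'\<close> and the induced metric on \<open>M\<close>. The Codazzi condition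
  for \<open>D'\<close> itself follows from that for \<open>D\<close> by duality (\<open>codazzi_dual\<close>).

  The analytic content is hidden in the word "tangential": \<open>D\<close> acts on vector fields on \<open>N\<close>, so
  \<open>X\<close>, \<open>Y\<close>, \<open>Z\<close> must first be extended to \<open>N\<close> near each point of \<open>M\<close>
  (\<open>vector_field_local_extension\<close>). The components of a field on \<open>M\<close> are smooth functions on \<open>M\<close>. They
  are extended to an open set in \<open>N\<close> by composition with a smooth local left inverse of the inclusion
  (\<open>smooth_immersion_left_inverse\<close>), and made global by a bump function (\<open>smooth_bump_function\<close>).
  The left inverse comes from the inverse function theorem; that it is smooth, and not only
  differentiable, rests on the smoothness of operator inversion (\<open>Ck_on_operator_inverse\<close>).

  The same extensions show that the functions \<open>g (Y, Z)\<close> on \<open>M\<close> are smooth and that \<open>X\<close> differentiates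
  them as its extension does on \<open>N\<close> (\<open>field_app_induced_pairing\<close>).
\<close>

section \<open>Differentiability classes on open sets\<close>

lemma Ck_on_subset: "Ck_on k S f \<Longrightarrow> T \<subseteq> S \<Longrightarrow> Ck_on k T f"
  by (induction k arbitrary: f) (auto intro: continuous_on_subset)

lemma Ck_on_cong:
  assumes "open S" "Ck_on k S f" "\<And>x. x \<in> S \<Longrightarrow> f x = g x"
  shows "Ck_on k S g"
  using assms(2,3)
proof (induction k arbitrary: f g)
  case 0
  then show ?case by (simp cong: continuous_on_cong)
next
  case (Suc k)
  have "g differentiable (at x)" if "x \<in> S" for x
    using Suc.prems that \<open>open S\<close>
    by (metis Ck_on.simps(2) differentiable_def has_derivative_transform_within_open)
  moreover have "Ck_on k S (\<lambda>x. frechet_derivative g (at x) v)" for v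
  proof (rule Suc.IH)
    show "Ck_on k S (\<lambda>x. frechet_derivative f (at x) v)" using Suc.prems by simp
    show "frechet_derivative f (at x) v = frechet_derivative g (at x) v" if "x \<in> S" for x
      using frechet_derivative_transform_within_open[of f x S g] Suc.prems that \<open>open S\<close> by auto
  qed
  ultimately show ?case by simp
qed

lemma Ck_on_Suc_imp_Ck_on: "Ck_on (Suc k) S f \<Longrightarrow> Ck_on k S f"
proof (induction k arbitrary: f)
  case 0
  then show ?case
    by (auto intro!: continuous_at_imp_continuous_on differentiable_imp_continuous_within)
next
  case (Suc k)
  then show ?case by (metis Ck_on.simps(2))
qed

lemma Ck_on_local:
  assumes "\<And>x. x \<in> S \<Longrightarrow> \<exists>T. open T \<and> x \<in> T \<and> Ck_on k T f"
  shows "Ck_on k S f"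
  using assms
proof (induction k arbitrary: f)
  case 0
  have "isCont f x" if "x \<in> S" for x
    using 0[OF that] by (auto simp: continuous_on_eq_continuous_at)
  then show ?case by (simp add: continuous_at_imp_continuous_on)
next
  case (Suc k)
  have "f differentiable (at x)" if "x \<in> S" for x using Suc.prems[OF that] by auto
  moreover have "Ck_on k S (\<lambda>x. frechet_derivative f (at x) v)" for v
    by (rule Suc.IH) (use Suc.prems in force)
  ultimately show ?case by simp
qed

lemma Ck_on_const [simp]: "Ck_on k S (\<lambda>x. c)"
  by (induction k arbitrary: c) auto

text \<open>The class \<open>Ck_on\<close> is stated with \<open>frechet_derivative\<close>, a choice operator. Together with the
  next rule this one lets all inductions on \<open>k\<close> run on explicit derivatives instead.\<close>

lemma Ck_on_SucI:
  assumes "open S" "\<And>x. x \<in> S \<Longrightarrow> (f has_derivative f' x) (at x)" "\<And>v. Ck_on k S (\<lambda>x. f' x v)"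
  shows "Ck_on (Suc k) S f"
proof -
  have "Ck_on k S (\<lambda>x. frechet_derivative f (at x) v)" for v
    by (rule Ck_on_cong[OF assms(1,3)]) (simp add: frechet_derivative_at[OF assms(2), symmetric])
  then show ?thesis using assms(2) by (auto intro: differentiableI)
qed

lemma Ck_on_SucD:
  assumes "Ck_on (Suc k) S f" "x \<in> S"
  shows "(f has_derivative frechet_derivative f (at x)) (at x)"
  using assms by (auto simp: frechet_derivative_works)

lemma Ck_on_linear:
  assumes "bounded_linear L" "open S" shows "Ck_on k S L"
proof (cases k)
  case 0
  then show ?thesis using assms(1) by (simp add: linear_continuous_on)
next
  case (Suc j)
  have "Ck_on (Suc j) S L"
    by (rule Ck_on_SucI[OF assms(2) bounded_linear_imp_has_derivative[OF assms(1)]]) simp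
  then show ?thesis using Suc by simp
qed

lemma Ck_on_add:
  assumes "open S" "Ck_on k S f" "Ck_on k S g"
  shows "Ck_on k S (\<lambda>x. f x + g x)"
  using assms(2,3)
proof (induction k arbitrary: f g)
  case 0
  then show ?case by (simp add: continuous_on_add)
next
  case (Suc k)
  show ?case
    by (rule Ck_on_SucI[OF assms(1) has_derivative_add[OF Ck_on_SucD[OF Suc.prems(1)] Ck_on_SucD[OF Suc.prems(2)]]])
       (use Suc in auto)
qed

lemma Ck_on_sum:
  assumes "open S" "\<And>i. i \<in> I \<Longrightarrow> Ck_on k S (f i)"
  shows "Ck_on k S (\<lambda>x. \<Sum>i\<in>I. f i x)"
  using assms(2)
  by (induction I rule: infinite_finite_induct) (auto intro: Ck_on_add[OF assms(1)])

lemma Ck_on_bilinear: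
  assumes "bounded_bilinear b" "open S" "Ck_on k S f" "Ck_on k S g"
  shows "Ck_on k S (\<lambda>x. b (f x) (g x))"
  using assms(3,4)
proof (induction k arbitrary: f g)
  case 0
  then show ?case using bounded_bilinear.continuous_on[OF assms(1)] by auto
next
  case (Suc k)
  show ?case
  proof (rule Ck_on_SucI[OF assms(2) bounded_bilinear.FDERIV[OF assms(1) Ck_on_SucD[OF Suc.prems(1)] Ck_on_SucD[OF Suc.prems(2)]]])
    show "Ck_on k S (\<lambda>x. b (f x) (frechet_derivative g (at x) v) + b (frechet_derivative f (at x) v) (g x))" for v
      using Suc.prems Ck_on_Suc_imp_Ck_on[OF Suc.prems(1)] Ck_on_Suc_imp_Ck_on[OF Suc.prems(2)]
      by (intro Ck_on_add[OF assms(2)] Suc.IH) auto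
  qed
qed

lemma Ck_on_bounded_linear:
  assumes "bounded_linear L" "open S" "Ck_on k S f"
  shows "Ck_on k S (\<lambda>x. L (f x))"
  using Ck_on_bilinear[OF bounded_bilinear_blinfun_apply assms(2) Ck_on_const assms(3), of "Blinfun L"]
  by (simp add: bounded_linear_Blinfun_apply[OF assms(1)])

lemma Ck_on_inner_const:
  assumes "open S" "Ck_on k S f" shows "Ck_on k S (\<lambda>x. f x \<bullet> b)"
  by (rule Ck_on_bilinear[OF bounded_bilinear_inner assms]) simp

text \<open>Writing the direction in coordinates turns \<open>f' x (v x)\<close>, where base point and direction both
  vary, into a finite sum of products of scalar functions and partial derivatives, to which the
  product rule applies.\<close>

lemma derivative_euclidean_expansion:
  assumes "(f has_derivative f') F"
  shows "f' v = (\<Sum>b\<in>Basis. (v \<bullet> b) *\<^sub>R f' b)"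
proof -
  interpret bounded_linear f' using assms by (rule has_derivative_bounded_linear)
  have "f' v = f' (\<Sum>b\<in>Basis. (v \<bullet> b) *\<^sub>R b)" by (simp add: euclidean_representation)
  then show ?thesis by (simp add: sum scaleR)
qed

text \<open>The chain rule gives \<open>g' (f x) (f' x v)\<close>; expanded over the basis, the factors \<open>g' (f x) b\<close> are
  compositions of one order less, so the induction generalizes over \<open>g\<close>.\<close>

lemma Ck_on_compose:
  assumes "open S" "open T" "Ck_on k T g" "Ck_on k S f" "\<And>x. x \<in> S \<Longrightarrow> f x \<in> T"
  shows "Ck_on k S (\<lambda>x. g (f x))"
  using assms(3,4)
proof (induction k arbitrary: g)
  case 0
  then show ?case using assms(5) by (auto intro: continuous_on_compose2)
next
  case (Suc k)
  note g = Ck_on_SucD[OF Suc.prems(1)] and f = Ck_on_SucD[OF Suc.prems(2)]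
  have fk: "Ck_on k S f" using Ck_on_Suc_imp_Ck_on[OF Suc.prems(2)] .
  show ?case
  proof (rule Ck_on_SucI[OF assms(1)])
    show "((\<lambda>x. g (f x)) has_derivative (\<lambda>v. \<Sum>b\<in>Basis. (frechet_derivative f (at x) v \<bullet> b) *\<^sub>R
        frechet_derivative g (at (f x)) b)) (at x)" if "x \<in> S" for x
      using has_derivative_compose[OF f[OF that] g[OF assms(5)[OF that]]]
      by (subst (asm) derivative_euclidean_expansion[OF g[OF assms(5)[OF that]]])
    show "Ck_on k S (\<lambda>x. \<Sum>b\<in>Basis. (frechet_derivative f (at x) v \<bullet> b) *\<^sub>R
        frechet_derivative g (at (f x)) b)" for v
      using Suc.prems fk
      by (intro Ck_on_sum Ck_on_bilinear[OF bounded_bilinear_scaleR] Ck_on_inner_const Suc.IH assms(1)) auto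
  qed
qed

text \<open>The derivative as a map into the normed space of operators is a finite sum of rank one operators
  built from the partial derivatives. This form makes it possible to invert derivatives
  differentiably.\<close>

lemma Ck_on_Blinfun_derivative:
  fixes f :: "'e::euclidean_space \<Rightarrow> 'f::real_normed_vector"
  assumes "open S" "Ck_on (Suc k) S f"
  shows "Ck_on k S (\<lambda>x. Blinfun (frechet_derivative f (at x)))"
proof -
  \<comment> \<open>the operator sending a vector to its \<open>b\<close>-coordinate times \<open>w\<close>\<close>
  define rank1 :: "'e \<Rightarrow> 'f \<Rightarrow> 'e \<Rightarrow>\<^sub>L 'f"
    where "rank1 b w = blinfun_scaleR_left w o\<^sub>L blinfun_inner_left b" for b w
  have rank1_apply: "rank1 b w v = (v \<bullet> b) *\<^sub>R w" for b v w
    by (simp add: rank1_def inner_commute)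
  have lin: "bounded_linear (rank1 b)" for b
    unfolding rank1_def
    by (intro bounded_linear_compose[OF bounded_bilinear.bounded_linear_left[OF bounded_bilinear_blinfun_compose]]
        bounded_linear_blinfun_scaleR_left)
  have "Ck_on k S (\<lambda>x. \<Sum>b\<in>Basis. rank1 b (frechet_derivative f (at x) b))"
    using assms
    by (intro Ck_on_sum Ck_on_bounded_linear[OF lin]) auto
  then show ?thesis
  proof (rule Ck_on_cong[OF assms(1)])
    fix x assume "x \<in> S"
    note f = Ck_on_SucD[OF assms(2) this]
    show "(\<Sum>b\<in>Basis. rank1 b (frechet_derivative f (at x) b)) = Blinfun (frechet_derivative f (at x))"
      by (rule blinfun_eqI)
         (simp add: blinfun.sum_left rank1_apply bounded_linear_Blinfun_apply[OF has_derivative_bounded_linear[OF f]]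
            derivative_euclidean_expansion[OF f, symmetric])
  qed
qed

section \<open>Smooth left inverses of immersions\<close>

text \<open>A product rule in which one factor is merely continuous: this suffices where the other
  factor vanishes, because the increment of the first factor is then multiplied by a term of first
  order.\<close>

lemma has_derivative_bilinear_zero:
  assumes "bounded_bilinear b" "isCont K x" "(F has_derivative F') (at x)" "F x = 0"
  shows "((\<lambda>y. b (K y) (F y)) has_derivative (\<lambda>v. b (K x) (F' v))) (at x)"
proof -
  interpret b: bounded_bilinear b by fact
  obtain C where C: "C > 0" "\<And>u w. norm (b u w) \<le> norm u * norm w * C" using b.pos_bounded by blast
  obtain M where M: "M > 0" "\<And>v. norm (F' v) \<le> norm v * M"
    using bounded_linear.pos_bounded[OF has_derivative_bounded_linear[OF assms(3)]] by blast
  \<comment> \<open>the relative error of the linear approximation, so that \<open>norm (F y) \<le> (\<rho> y + M) * norm (y - x)\<close>\<close>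
  define \<rho> where "\<rho> y = norm (F y - F x - F' (y - x)) / norm (y - x)" for y
  have \<rho>: "(\<rho> \<longlongrightarrow> 0) (at x)"
    using assms(3) unfolding has_derivative_iff_norm \<rho>_def by simp
  have "((\<lambda>y. b (K y - K x) (F y)) has_derivative (\<lambda>v. 0)) (at x)"
    unfolding has_derivative_iff_norm
  proof
    have "((\<lambda>y. norm (K y - K x) * (\<rho> y + M) * C) \<longlongrightarrow> norm (K x - K x) * (0 + M) * C) (at x)"
      using assms(2) \<rho> by (intro tendsto_intros) (simp_all add: isCont_def)
    then have lim: "((\<lambda>y. norm (K y - K x) * (\<rho> y + M) * C) \<longlongrightarrow> 0) (at x)" by simp
    have "norm (norm (b (K y - K x) (F y) - b (K x - K x) (F x) - 0) / norm (y - x))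
        \<le> norm (K y - K x) * (\<rho> y + M) * C" if "y \<noteq> x" for y
    proof -
      have "norm (F y) \<le> norm (F y - F' (y - x)) + norm (F' (y - x))"
        using norm_triangle_ineq[of "F y - F' (y - x)" "F' (y - x)"] by simp
      also have "\<dots> \<le> (\<rho> y + M) * norm (y - x)"
        using that M(2)[of "y - x"] assms(4) by (simp add: \<rho>_def field_simps)
      finally have "norm (b (K y - K x) (F y)) \<le> norm (K y - K x) * ((\<rho> y + M) * norm (y - x)) * C"
        using C by (meson mult_left_mono mult_right_mono norm_ge_zero order_trans less_imp_le)
      then show ?thesis using that by (simp add: field_simps b.zero_left)
    qed
    then show "((\<lambda>y. norm (b (K y - K x) (F y) - b (K x - K x) (F x) - 0) / norm (y - x)) \<longlongrightarrow> 0) (at x)"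
      by (intro Lim_null_comparison[OF _ lim]) (simp add: eventually_at_filter)
  qed simp
  from has_derivative_add[OF this bounded_linear.has_derivative[OF b.bounded_linear_right assms(3), of "K x"]]
  show ?thesis by (simp add: b.diff_left)
qed

text \<open>From \<open>B y - B x = B y (G x - G y) B x\<close> one first gets that \<open>B\<close> is bounded by \<open>2 * norm (B x)\<close>
  near \<open>x\<close>, and then, from the same identity, continuity.\<close>

lemma isCont_operator_inverse:
  fixes G :: "'a::real_normed_vector \<Rightarrow> ('b::real_normed_vector \<Rightarrow>\<^sub>L 'c::real_normed_vector)"
  assumes "open S" "x \<in> S" "isCont G x"
    and inv: "\<And>y. y \<in> S \<Longrightarrow> B y o\<^sub>L G y = id_blinfun" "\<And>y. y \<in> S \<Longrightarrow> G y o\<^sub>L B y = id_blinfun"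
  shows "isCont B x"
proof -
  define d where "d y = norm (G x - G y) * norm (B x)" for y
  have "((\<lambda>y. norm (G x - G y) * norm (B x)) \<longlongrightarrow> norm (G x - G x) * norm (B x)) (at x)"
    using assms(3) by (intro tendsto_intros) (simp add: isCont_def)
  then have d: "(d \<longlongrightarrow> 0) (at x)" by (simp add: d_def[abs_def])
  have "eventually (\<lambda>y. d y < 1/2) (at x)" using order_tendstoD(2)[OF d, of "1/2"] by simp
  moreover have "eventually (\<lambda>y. y \<in> S) (at x)"
    using assms(1,2) by (simp add: eventually_at_in_open')
  ultimately have "eventually (\<lambda>y. norm (B y - B x) \<le> 2 * norm (B x) * d y) (at x)"
  proof eventually_elim
    case (elim y)
    have "B y - B x = B y o\<^sub>L (G x - G y) o\<^sub>L B x"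
    proof (rule blinfun_eqI)
      fix v
      have "G x (B x v) = v" using inv(2)[OF assms(2)] by (metis blinfun_apply_blinfun_compose blinfun_apply_id_blinfun)
      moreover have "B y (G y (B x v)) = B x v"
        using inv(1)[OF elim(2)] by (metis blinfun_apply_blinfun_compose blinfun_apply_id_blinfun)
      ultimately show "(B y - B x) v = (B y o\<^sub>L (G x - G y) o\<^sub>L B x) v"
        by (simp add: blinfun.diff_left blinfun.diff_right)
    qed
    then have "norm (B y - B x) \<le> norm (B y o\<^sub>L (G x - G y)) * norm (B x)"
      by (simp add: norm_blinfun_compose)
    also have "\<dots> \<le> norm (B y) * norm (G x - G y) * norm (B x)"
      by (intro mult_right_mono norm_blinfun_compose) simp
    finally have 1: "norm (B y - B x) \<le> norm (B y) * d y" by (simp add: d_def)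
    have d0: "0 \<le> d y" by (simp add: d_def)
    have "norm (B y) \<le> norm (B x) + norm (B y - B x)" using norm_triangle_ineq[of "B x" "B y - B x"] by simp
    moreover have "norm (B y) * d y \<le> norm (B y) * (1/2)" using elim by (intro mult_left_mono) auto
    ultimately have "norm (B y) \<le> 2 * norm (B x)" using 1 by simp
    then show ?case using 1 d0 by (meson mult_right_mono order_trans)
  qed
  moreover have "((\<lambda>y. 2 * norm (B x) * d y) \<longlongrightarrow> 0) (at x)" using tendsto_mult_right_zero[OF d] by blast
  ultimately have "((\<lambda>y. B y - B x) \<longlongrightarrow> 0) (at x)" by (rule Lim_null_comparison)
  then show ?thesis by (simp add: isCont_def Lim_null[symmetric])
qed

text \<open>Since \<open>B y = B x - B y (G y - G x) B x\<close> and \<open>B\<close> is continuous, \<open>B\<close> has the derivative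
  \<open>- B G' B\<close>. That expression involves \<open>B\<close> only to order \<open>k\<close>, which closes the induction.\<close>

lemma Ck_on_operator_inverse:
  fixes G :: "'e::euclidean_space \<Rightarrow> ('b::real_normed_vector \<Rightarrow>\<^sub>L 'c::real_normed_vector)"
  assumes "open S" "Ck_on k S G"
    and inv: "\<And>y. y \<in> S \<Longrightarrow> B y o\<^sub>L G y = id_blinfun" "\<And>y. y \<in> S \<Longrightarrow> G y o\<^sub>L B y = id_blinfun"
  shows "Ck_on k S B"
  using assms(2)
proof (induction k)
  case 0
  then show ?case
    using isCont_operator_inverse[OF assms(1) _ _ inv] assms(1)
    by (auto simp: continuous_on_eq_continuous_at)
next
  case (Suc k)
  have BG: "B y (G y v) = v" "G y (B y w) = w" if "y \<in> S" for y v w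
    using inv[OF that] by (metis blinfun_apply_blinfun_compose blinfun_apply_id_blinfun)+
  have Bk: "Ck_on k S B" using Suc.IH Ck_on_Suc_imp_Ck_on[OF Suc.prems] .
  show ?case
  proof (rule Ck_on_SucI[OF assms(1)])
    fix x assume x: "x \<in> S"
    note G = Ck_on_SucD[OF Suc.prems x]
    have "isCont G x" using G by (rule has_derivative_continuous)
    then have cont: "isCont B x" by (rule isCont_operator_inverse[OF assms(1) x _ inv])
    have 1: "((\<lambda>y. (G y - G x) o\<^sub>L B x) has_derivative (\<lambda>v. frechet_derivative G (at x) v o\<^sub>L B x)) (at x)"
      using has_derivative_diff[OF G has_derivative_const, of "G x"]
      by (intro bounded_linear.has_derivative[OF bounded_bilinear.bounded_linear_left[OF bounded_bilinear_blinfun_compose]]) simp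
    have "((\<lambda>y. B x - (B y o\<^sub>L ((G y - G x) o\<^sub>L B x))) has_derivative
        (\<lambda>v. 0 - (B x o\<^sub>L (frechet_derivative G (at x) v o\<^sub>L B x)))) (at x)"
      by (intro has_derivative_diff has_derivative_const
          has_derivative_bilinear_zero[OF bounded_bilinear_blinfun_compose cont 1])
         (auto intro: blinfun_eqI)
    moreover have "B x - (B y o\<^sub>L ((G y - G x) o\<^sub>L B x)) = B y" if "y \<in> S" for y
      by (rule blinfun_eqI) (simp add: blinfun.diff_left blinfun.diff_right BG that x)
    ultimately show "(B has_derivative (\<lambda>v. - 1 *\<^sub>R (B x o\<^sub>L (frechet_derivative G (at x) v o\<^sub>L B x)))) (at x)"
      by (auto intro: has_derivative_transform_within_open[OF _ assms(1) x])
  next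
    show "Ck_on k S (\<lambda>x. - 1 *\<^sub>R (B x o\<^sub>L (frechet_derivative G (at x) v o\<^sub>L B x)))" for v
      using Suc.prems
      by (intro Ck_on_bilinear[OF bounded_bilinear_scaleR] Ck_on_bilinear[OF bounded_bilinear_blinfun_compose]
          assms(1) Bk Ck_on_const) auto
  qed
qed

text \<open>Let \<open>A\<close> be a linear left inverse of the derivative of \<open>f\<close> at \<open>x0\<close>. Then \<open>A \<circ> f\<close> is a map between
  spaces of equal dimension whose derivative at \<open>x0\<close> is the identity. If \<open>\<psi>\<close> is its local inverse,
  \<open>\<psi> \<circ> A\<close> is a left inverse of \<open>f\<close>, defined on an open set of the larger space. Composing with it
  extends functions from the image of \<open>f\<close>.\<close>

lemma smooth_immersion_left_inverse:
  fixes f :: "'m::euclidean_space \<Rightarrow> 'e::euclidean_space"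
  assumes "open U" "smooth_on U f" "x0 \<in> U" "inj (frechet_derivative f (at x0))"
  obtains U' P \<pi> where "open U'" "x0 \<in> U'" "U' \<subseteq> U" "open P" "smooth_on P \<pi>"
    "\<And>y. y \<in> P \<Longrightarrow> \<pi> y \<in> U'" "\<And>x. x \<in> U' \<Longrightarrow> f x \<in> P" "\<And>x. x \<in> U' \<Longrightarrow> \<pi> (f x) = x"
proof -
  have Ck: "Ck_on k U f" for k using assms(2) by (simp add: smooth_on_def)
  have df: "(f has_derivative frechet_derivative f (at x)) (at x)" if "x \<in> U" for x
    by (rule Ck_on_SucD[OF Ck that])
  obtain A where A: "linear A" "A \<circ> frechet_derivative f (at x0) = id"
    using linear_injective_left_inverse[OF has_derivative_linear[OF df[OF assms(3)]] assms(4)] by auto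
  have blA: "bounded_linear A" using A(1) by (simp add: linear_conv_bounded_linear)
  define h where "h x = A (f x)" for x
  have hk: "Ck_on k U h" for k
    unfolding h_def by (rule Ck_on_bounded_linear[OF blA assms(1) Ck])
  define h' where "h' x = Blinfun (frechet_derivative h (at x))" for x
  have h'_apply: "blinfun_apply (h' x) = frechet_derivative h (at x)" if "x \<in> U" for x
    unfolding h'_def by (rule bounded_linear_Blinfun_apply[OF has_derivative_bounded_linear[OF Ck_on_SucD[OF hk that]]])
  have h'k: "Ck_on k U h'" for k
    unfolding h'_def by (rule Ck_on_Blinfun_derivative[OF assms(1) hk])
  have "(h has_derivative (\<lambda>v. A (frechet_derivative f (at x0) v))) (at x0)"
    unfolding h_def by (rule bounded_linear.has_derivative[OF blA df[OF assms(3)]])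
  then have "frechet_derivative h (at x0) = id"
    using A(2) by (simp add: frechet_derivative_at[symmetric] comp_def)
  then have "id_blinfun o\<^sub>L h' x0 = id_blinfun"
    by (intro blinfun_eqI) (simp add: h'_apply assms(3))
  moreover have "continuous_on U h'" using h'k[of 0] by simp
  ultimately obtain U' V \<psi> \<psi>' where IFT: "open U'" "U' \<subseteq> U" "x0 \<in> U'" "open V" "homeomorphism U' V h \<psi>"
    "\<And>y. y \<in> V \<Longrightarrow> (\<psi> has_derivative \<psi>' y) (at y)"
    "\<And>y. y \<in> V \<Longrightarrow> \<psi>' y = inv (blinfun_apply (h' (\<psi> y)))"
    "\<And>y. y \<in> V \<Longrightarrow> bij (blinfun_apply (h' (\<psi> y)))"
    using inverse_function_theorem[OF assms(1) _ _ assms(3), of h h' id_blinfun]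
      Ck_on_SucD[OF hk] h'_apply by metis
  have \<psi>U: "\<psi> y \<in> U'" if "y \<in> V" for y
    using IFT(5) that by (auto simp: homeomorphism_def)
  \<comment> \<open>the derivative of \<open>\<psi>\<close> is the inverse operator of \<open>h' \<circ> \<psi>\<close>, hence as regular as \<open>\<psi>\<close> itself\<close>
  have \<psi>k: "Ck_on k V \<psi>" for k
  proof (induction k)
    case 0
    show ?case using IFT(5) by (simp add: homeomorphism_def)
  next
    case (Suc k)
    define B where "B y = Blinfun (\<psi>' y)" for y
    have B_apply: "blinfun_apply (B y) = \<psi>' y" if "y \<in> V" for y
      unfolding B_def by (rule bounded_linear_Blinfun_apply[OF has_derivative_bounded_linear[OF IFT(6)[OF that]]])
    have "Ck_on k V (\<lambda>y. h' (\<psi> y))"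
      using \<psi>U IFT(2) by (intro Ck_on_compose[OF IFT(4) assms(1) h'k Suc]) auto
    then have "Ck_on k V B"
    proof (rule Ck_on_operator_inverse[OF IFT(4)])
      fix y assume y: "y \<in> V"
      show "B y o\<^sub>L h' (\<psi> y) = id_blinfun" "h' (\<psi> y) o\<^sub>L B y = id_blinfun"
        using IFT(8)[OF y]
        by (auto intro!: blinfun_eqI simp: B_apply[OF y] IFT(7)[OF y] bij_is_inj bij_is_surj surj_f_inv_f)
    qed
    then have "Ck_on k V (\<lambda>y. B y v)" for v
      by (intro Ck_on_bilinear[OF bounded_bilinear_blinfun_apply IFT(4)]) auto
    then have "Ck_on k V (\<lambda>y. \<psi>' y v)" for v
      by (rule Ck_on_cong[OF IFT(4)]) (simp add: B_apply)
    with IFT(6) show ?case by (intro Ck_on_SucI[OF IFT(4)])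
  qed
  show ?thesis
  proof
    show "open U'" "x0 \<in> U'" "U' \<subseteq> U" by fact+
    show P: "open (A -` V)" using IFT(4) blA by (simp add: linear_continuous_on continuous_open_vimage linear_continuous_at)
    show "smooth_on (A -` V) (\<lambda>y. \<psi> (A y))"
      unfolding smooth_on_def
      by (intro allI Ck_on_compose[OF P IFT(4) \<psi>k Ck_on_linear[OF blA P]]) auto
    show "\<psi> (A y) \<in> U'" if "y \<in> A -` V" for y using \<psi>U that by auto
    show "f x \<in> A -` V" "\<psi> (A (f x)) = x" if "x \<in> U'" for x
      using IFT(5) that by (auto simp: homeomorphism_def h_def)
  qed
qed

section \<open>Bump functions\<close>

text \<open>The family \<open>exp (-1/t) / t ^ n\<close> on the positive half line, extended by \<open>0\<close>, is used for all \<open>n\<close>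
  because its span is closed under differentiation.\<close>

definition flat_exp :: "nat \<Rightarrow> real \<Rightarrow> real" where
  "flat_exp n t = (if 0 < t then exp (- inverse t) * inverse t ^ n else 0)"

lemma tendsto_flat_exp_0: "(flat_exp n \<longlongrightarrow> 0) (at 0)"
proof (rule filterlim_split_at)
  show "(flat_exp n \<longlongrightarrow> 0) (at_left 0)"
    by (rule tendsto_eventually) (auto simp: eventually_at_filter flat_exp_def)
  have "((\<lambda>x::real. x ^ n / exp x) \<longlongrightarrow> 0) at_top" by (rule tendsto_power_div_exp_0)
  then have "((\<lambda>x. flat_exp n (inverse x)) \<longlongrightarrow> 0) at_top"
    by (rule Lim_transform_eventually)
       (auto simp: flat_exp_def exp_minus field_simps intro!: eventually_mono[OF eventually_gt_at_top[of 0]])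
  then show "(flat_exp n \<longlongrightarrow> 0) (at_right 0)" by (simp add: filterlim_at_right_to_top)
qed

text \<open>At \<open>0\<close> the difference quotient of \<open>flat_exp n\<close> is \<open>flat_exp (n + 1)\<close>, which tends to \<open>0\<close>.\<close>

lemma has_derivative_flat_exp:
  "(flat_exp n has_derivative (\<lambda>v. v * (flat_exp (n + 2) t - real n * flat_exp (n + 1) t))) (at t)"
proof -
  consider "t > 0" | "t < 0" | "t = 0" by linarith
  then have "(flat_exp n has_real_derivative (flat_exp (n + 2) t - real n * flat_exp (n + 1) t)) (at t)"
  proof cases
    case 1
    have "((\<lambda>t. exp (- inverse t) * inverse t ^ n) has_real_derivative
        (flat_exp (n + 2) t - real n * flat_exp (n + 1) t)) (at t)"
      using 1 by (auto intro!: derivative_eq_intros simp: flat_exp_def power2_eq_square algebra_simps)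
         (cases n; simp add: field_simps)
    then show ?thesis
      by (rule has_field_derivative_transform_within_open[of _ _ _ "{0<..}"]) (use 1 in \<open>auto simp: flat_exp_def\<close>)
  next
    case 2
    have "((\<lambda>t. 0) has_real_derivative (flat_exp (n + 2) t - real n * flat_exp (n + 1) t)) (at t)"
      using 2 by (simp add: flat_exp_def)
    then show ?thesis
      by (rule has_field_derivative_transform_within_open[of _ _ _ "{..<0}"]) (use 2 in \<open>auto simp: flat_exp_def\<close>)
  next
    case 3
    have "((\<lambda>h. (flat_exp n (0 + h) - flat_exp n 0) / h) \<longlongrightarrow> 0) (at 0)"
      by (rule Lim_transform_eventually[OF tendsto_flat_exp_0[of "n + 1"]])
         (auto simp: flat_exp_def eventually_at_filter field_simps)
    then show ?thesis using 3 by (simp add: DERIV_def flat_exp_def)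
  qed
  then show ?thesis by (simp add: has_field_derivative_def mult.commute[of _ "_ - _"] mult_commute_abs)
qed

lemma Ck_on_flat_exp: "Ck_on k UNIV (flat_exp n)"
proof (induction k arbitrary: n)
  case 0
  have "isCont (flat_exp n) t" for t using has_derivative_continuous[OF has_derivative_flat_exp] .
  then show ?case by (simp add: continuous_at_imp_continuous_on)
next
  case (Suc k)
  have "Ck_on k UNIV (\<lambda>t. v * (flat_exp (n + 2) t + (- real n) * flat_exp (n + 1) t))" for v :: real
    by (intro Ck_on_bilinear[OF bounded_bilinear_mult] Ck_on_add Suc) auto
  then show ?case by (intro Ck_on_SucI[OF _ has_derivative_flat_exp]) auto
qed

lemma Ck_on_inverse: "Ck_on k {0::real<..} inverse"
proof (induction k)
  case 0
  then show ?case by (auto intro!: continuous_intros)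
next
  case (Suc k)
  have "Ck_on k {0<..} (\<lambda>t. (- v) * (inverse t * inverse t))" for v :: real
    by (intro Ck_on_bilinear[OF bounded_bilinear_mult] Suc) auto
  moreover have "(inverse has_derivative (\<lambda>v. (- v) * (inverse t * inverse t))) (at t)" if "t \<in> {0<..}" for t :: real
    using that by (auto intro!: derivative_eq_intros)
  ultimately show ?case by (intro Ck_on_SucI) auto
qed

text \<open>The quotient \<open>a / (a + b)\<close>, where \<open>a\<close> is positive exactly for \<open>dist y0 y < 2 * e\<close> and \<open>b\<close> exactly
  for \<open>dist y0 y > e\<close>. The denominator never vanishes, and \<open>b = 0\<close> makes the quotient \<open>1\<close>. The square
  of the distance is used because the distance itself is not smooth at \<open>y0\<close>.\<close>

lemma smooth_bump_function:
  fixes y0 :: "'e::euclidean_space"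
  assumes "e > 0"
  obtains \<beta> :: "'e \<Rightarrow> real" where "smooth_on UNIV \<beta>" "\<And>y. dist y0 y < e \<Longrightarrow> \<beta> y = 1"
    "\<And>y. dist y0 y \<ge> 2 * e \<Longrightarrow> \<beta> y = 0"
proof
  define s where "s y = (y0 - y) \<bullet> (y0 - y)" for y
  define a where "a y = flat_exp 0 (4 * e\<^sup>2 - s y)" for y
  define b where "b y = flat_exp 0 (s y - e\<^sup>2)" for y
  have s_dist: "s y = (dist y0 y)\<^sup>2" for y by (simp add: s_def dist_norm power2_norm_eq_inner)
  have pos: "a y + b y > 0" for y
  proof -
    have "4 * e\<^sup>2 - s y > 0 \<or> s y - e\<^sup>2 > 0" using assms by (smt (verit) zero_less_power)
    then show ?thesis by (auto simp: a_def b_def flat_exp_def add_pos_nonneg add_nonneg_pos)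
  qed
  have shift: "Ck_on k UNIV (\<lambda>y. y0 - y)" for k
    using Ck_on_add[OF open_UNIV Ck_on_const Ck_on_linear[OF bounded_linear_minus[OF bounded_linear_ident] open_UNIV], of k y0] by simp
  have sk: "Ck_on k UNIV s" for k
    unfolding s_def by (intro Ck_on_bilinear[OF bounded_bilinear_inner] shift) auto
  have "Ck_on k UNIV (\<lambda>y. 4 * e\<^sup>2 + (- 1) *\<^sub>R s y)" "Ck_on k UNIV (\<lambda>y. s y + (- e\<^sup>2))" for k
    by (intro Ck_on_add Ck_on_bilinear[OF bounded_bilinear_scaleR] sk; simp)+
  then have ak: "Ck_on k UNIV a" and bk: "Ck_on k UNIV b" for k
    unfolding a_def b_def by (auto intro!: Ck_on_compose[OF _ _ Ck_on_flat_exp])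
  show "smooth_on UNIV (\<lambda>y. a y * inverse (a y + b y))"
    unfolding smooth_on_def
    by (intro allI Ck_on_bilinear[OF bounded_bilinear_mult] ak Ck_on_compose[OF _ _ Ck_on_inverse] Ck_on_add bk)
       (auto simp: pos)
  show "a y * inverse (a y + b y) = 1" if "dist y0 y < e" for y
  proof -
    have "s y < e\<^sup>2" using that by (simp add: s_dist power_strict_mono)
    then have "b y = 0" by (simp add: b_def flat_exp_def)
    then show ?thesis using pos[of y] by simp
  qed
  show "a y * inverse (a y + b y) = 0" if "dist y0 y \<ge> 2 * e" for y
  proof -
    have "s y \<ge> (2 * e)\<^sup>2" using that assms power_mono[of "2 * e" "dist y0 y" 2] by (simp only: s_dist)
    then show ?thesis by (simp add: a_def flat_exp_def power_mult_distrib)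
  qed
qed

text \<open>The open sets \<open>Q\<close> and \<open>- cball y0 e\<close> cover the space, and the function is a product of smooth
  functions on the first and \<open>0\<close> on the second.\<close>

lemma Ck_on_cutoff:
  assumes "open Q" "Ck_on k Q h" "Ck_on k UNIV \<beta>" "cball y0 e \<subseteq> Q" "\<And>y. y \<notin> cball y0 e \<Longrightarrow> \<beta> y = (0::real)"
  shows "Ck_on k UNIV (\<lambda>y. if y \<in> Q then \<beta> y *\<^sub>R h y else 0)"
proof (rule Ck_on_local)
  fix y
  show "\<exists>T. open T \<and> y \<in> T \<and> Ck_on k T (\<lambda>y. if y \<in> Q then \<beta> y *\<^sub>R h y else 0)"
  proof (cases "y \<in> Q")
    case True
    have "Ck_on k Q (\<lambda>y. \<beta> y *\<^sub>R h y)"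
      by (intro Ck_on_bilinear[OF bounded_bilinear_scaleR] assms Ck_on_subset[OF assms(3)]) simp
    then have "Ck_on k Q (\<lambda>y. if y \<in> Q then \<beta> y *\<^sub>R h y else 0)"
      by (rule Ck_on_cong[OF assms(1)]) simp
    then show ?thesis using True assms(1) by blast
  next
    case False
    have "Ck_on k (- cball y0 e) (\<lambda>y. if y \<in> Q then \<beta> y *\<^sub>R h y else 0)"
      by (rule Ck_on_cong[OF _ Ck_on_const]) (use assms(5) in auto)
    then show ?thesis using False assms(4) by (intro exI[of _ "- cball y0 e"]) auto
  qed
qed

section \<open>Charts and smooth functions\<close>

lemma smooth_manifold_chart:
  assumes "smooth_manifold M" "c \<in> atlas M"
  shows chart_openin: "openin (mtop M) (fst c)"
    and chart_image_open: "open (snd c ` fst c)"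
    and chart_homeomorphic: "homeomorphic_map (subtopology (mtop M) (fst c)) (top_of_set (snd c ` fst c)) (snd c)"
proof -
  have "\<forall>(U, \<phi>)\<in>atlas M. openin (mtop M) U \<and> open (\<phi> ` U) \<and>
        homeomorphic_map (subtopology (mtop M) U) (top_of_set (\<phi> ` U)) \<phi>"
    using assms(1) unfolding smooth_manifold_def by (elim conjE)
  from bspec[OF this assms(2)]
  show "openin (mtop M) (fst c)" "open (snd c ` fst c)"
    "homeomorphic_map (subtopology (mtop M) (fst c)) (top_of_set (snd c ` fst c)) (snd c)"
    unfolding case_prod_unfold by blast+
qed

lemma chart_subset_points:
  assumes "smooth_manifold M" "c \<in> atlas M" shows "fst c \<subseteq> points M"
  using chart_openin[OF assms] openin_subset by blast

lemma chart_inj_on: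
  assumes "smooth_manifold M" "c \<in> atlas M" shows "inj_on (snd c) (fst c)"
  using homeomorphic_imp_injective_map[OF chart_homeomorphic[OF assms]] chart_subset_points[OF assms]
  by (simp add: Int_absorb1)

lemma chart_around:
  assumes "smooth_manifold M" "p \<in> points M" obtains c where "c \<in> atlas M" "p \<in> fst c"
  using assms unfolding smooth_manifold_def by blast

lemma chart_inv_left:
  assumes "smooth_manifold M" "c \<in> atlas M" "q \<in> fst c" shows "chart_inv c (snd c q) = q"
  unfolding chart_inv_def by (rule the_inv_into_f_f[OF chart_inj_on[OF assms(1,2)] assms(3)])

lemma chart_inv_continuous:
  assumes "smooth_manifold M" "c \<in> atlas M"
  shows "continuous_map (top_of_set (snd c ` fst c)) (mtop M) (chart_inv c)"
proof -
  obtain h where h: "homeomorphic_maps (subtopology (mtop M) (fst c)) (top_of_set (snd c ` fst c)) (snd c) h"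
    using chart_homeomorphic[OF assms] by (auto simp: homeomorphic_map_maps)
  have "continuous_map (top_of_set (snd c ` fst c)) (mtop M) h"
    using h by (auto simp: homeomorphic_maps_def continuous_map_in_subtopology)
  then show ?thesis
  proof (rule continuous_map_eq)
    fix x assume "x \<in> topspace (top_of_set (snd c ` fst c))"
    then obtain q where q: "q \<in> fst c" "x = snd c q" by auto
    then have "h x = q" using h chart_subset_points[OF assms] by (auto simp: homeomorphic_maps_def)
    then show "h x = chart_inv c x" using chart_inv_left[OF assms] q by simp
  qed
qed

lemma chart_image_of_open:
  assumes "smooth_manifold M" "c \<in> atlas M" "openin (mtop M) W" "W \<subseteq> fst c"
  shows "open (snd c ` W)"
proof -
  have "openin (subtopology (mtop M) (fst c)) W"
    using assms by (simp add: openin_open_subtopology chart_openin)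
  then have "openin (top_of_set (snd c ` fst c)) (snd c ` W)"
    using homeomorphic_imp_open_map[OF chart_homeomorphic[OF assms(1,2)]] by (simp add: open_map_def)
  then show ?thesis using chart_image_open[OF assms(1,2)] by (simp add: openin_open_eq)
qed

lemma chart_preimage_openin:
  assumes "smooth_manifold M" "c \<in> atlas M" "open T"
  shows "openin (mtop M) {q \<in> fst c. snd c q \<in> T}"
proof -
  have "openin (top_of_set (snd c ` fst c)) (snd c ` fst c \<inter> T)" using assms(3) by (simp add: openin_open_Int)
  then have "openin (subtopology (mtop M) (fst c)) {q \<in> topspace (subtopology (mtop M) (fst c)). snd c q \<in> snd c ` fst c \<inter> T}"
    using homeomorphic_imp_continuous_map[OF chart_homeomorphic[OF assms(1,2)]] by (rule openin_continuous_map_preimage[rotated])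
  moreover have "{q \<in> topspace (subtopology (mtop M) (fst c)). snd c q \<in> snd c ` fst c \<inter> T} = {q \<in> fst c. snd c q \<in> T}"
    using chart_subset_points[OF assms(1,2)] by auto
  ultimately show ?thesis using chart_openin[OF assms(1,2)] by (simp add: openin_open_subtopology)
qed

text \<open>The part of being a submanifold that concerns smoothness only. Unlike \<open>submanifold\<close> it holds
  between a smooth manifold and itself, so that changes of charts in \<open>N\<close> and pullbacks from \<open>N\<close> to \<open>M\<close> are instances of the
  same lemmas.\<close>

definition smooth_inclusion :: "('a, 'e::euclidean_space) mfd \<Rightarrow> ('a, 'm::euclidean_space) mfd \<Rightarrow> bool" where
  "smooth_inclusion N M \<longleftrightarrow> smooth_manifold N \<and> smooth_manifold M \<and>
     points M \<subseteq> points N \<and> continuous_map (mtop M) (mtop N) (\<lambda>p. p) \<and>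
     (\<forall>c\<in>atlas M. \<forall>d\<in>atlas N. smooth_on (snd c ` (fst c \<inter> fst d)) (snd d \<circ> chart_inv c))"

lemma smooth_inclusion_submanifold:
  "smooth_manifold N \<Longrightarrow> submanifold N M \<Longrightarrow> smooth_inclusion N M"
  by (simp add: smooth_inclusion_def submanifold_def)

lemma smooth_inclusion_refl:
  assumes "smooth_manifold N" shows "smooth_inclusion N N"
proof -
  have "\<forall>c\<in>atlas N. \<forall>d\<in>atlas N. smooth_on (snd c ` (fst c \<inter> fst d)) (snd d \<circ> chart_inv c)"
    using assms unfolding smooth_manifold_def by (elim conjE)
  then show ?thesis using assms by (simp add: smooth_inclusion_def)
qed

lemma smooth_inclusion_manifolds:
  assumes "smooth_inclusion N M" shows "smooth_manifold N" "smooth_manifold M"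
  using assms unfolding smooth_inclusion_def by blast+

lemma smooth_inclusion_Ck_on:
  assumes "smooth_inclusion N M" "c \<in> atlas M" "d \<in> atlas N"
  shows "Ck_on k (snd c ` (fst c \<inter> fst d)) (snd d \<circ> chart_inv c)"
  using assms unfolding smooth_inclusion_def smooth_on_def by blast

lemma smooth_inclusion_openin:
  assumes "smooth_inclusion N M" "openin (mtop N) W"
  shows "openin (mtop M) (points M \<inter> W)"
proof -
  have "openin (mtop M) {q \<in> points M. q \<in> W}"
    using assms by (intro openin_continuous_map_preimage) (auto simp: smooth_inclusion_def)
  moreover have "{q \<in> points M. q \<in> W} = points M \<inter> W" by blast
  ultimately show ?thesis by simp
qed

lemma charts_overlap_openin:
  assumes "smooth_inclusion N M" "c \<in> atlas M" "d \<in> atlas N"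
  shows "openin (mtop M) (fst c \<inter> fst d)"
proof -
  note M = smooth_inclusion_manifolds[OF assms(1)]
  have "openin (mtop M) (fst c \<inter> (points M \<inter> fst d))"
    by (intro openin_Int chart_openin[OF M(2) assms(2)] smooth_inclusion_openin[OF assms(1)] chart_openin[OF M(1) assms(3)])
  then show ?thesis using chart_subset_points[OF M(2) assms(2)] by (simp add: Int_assoc[symmetric] Int_absorb2)
qed

lemma smooth_fun_on_cong:
  assumes "smooth_manifold M" "openin (mtop M) V" "smooth_fun_on M V f" "\<And>q. q \<in> V \<Longrightarrow> f q = h q"
  shows "smooth_fun_on M V h"
  unfolding smooth_fun_on_def smooth_on_def
proof (intro ballI allI)
  fix c k assume c: "c \<in> atlas M"
  have "open (snd c ` (V \<inter> fst c))"
    using assms(2) chart_openin[OF assms(1) c] by (intro chart_image_of_open[OF assms(1) c]) auto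
  moreover have "Ck_on k (snd c ` (V \<inter> fst c)) (f \<circ> chart_inv c)"
    using assms(3) c by (simp add: smooth_fun_on_def smooth_on_def)
  ultimately show "Ck_on k (snd c ` (V \<inter> fst c)) (h \<circ> chart_inv c)"
    by (rule Ck_on_cong) (use assms(4) chart_inv_left[OF assms(1) c] in auto)
qed

lemma smooth_fun_on_local:
  assumes "smooth_manifold M"
    and "\<And>p. p \<in> U \<Longrightarrow> \<exists>V. openin (mtop M) V \<and> p \<in> V \<and> smooth_fun_on M V f"
  shows "smooth_fun_on M U f"
  unfolding smooth_fun_on_def smooth_on_def
proof (intro ballI allI Ck_on_local)
  fix c k x assume c: "c \<in> atlas M" and "x \<in> snd c ` (U \<inter> fst c)"
  then obtain p where p: "p \<in> U" "p \<in> fst c" "x = snd c p" by auto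
  obtain V where V: "openin (mtop M) V" "p \<in> V" "smooth_fun_on M V f" using assms(2)[OF p(1)] by auto
  have "open (snd c ` (V \<inter> fst c))"
    using V chart_openin[OF assms(1) c] by (intro chart_image_of_open[OF assms(1) c]) auto
  then show "\<exists>T. open T \<and> x \<in> T \<and> Ck_on k T (f \<circ> chart_inv c)"
    using V p c by (intro exI[of _ "snd c ` (V \<inter> fst c)"]) (auto simp: smooth_fun_on_def smooth_on_def)
qed

text \<open>Smoothness of a function on \<open>M\<close> may be tested in a single chart of the ambient manifold.\<close>

lemma smooth_fun_on_chart_expression:
  assumes "smooth_inclusion N M" "d \<in> atlas N" "open P" "smooth_on P \<phi>"
    and "openin (mtop M) V" "V \<subseteq> fst d" "snd d ` V \<subseteq> P"
  shows "smooth_fun_on M V (\<lambda>q. \<phi> (snd d q))"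
  unfolding smooth_fun_on_def smooth_on_def
proof (intro ballI allI)
  fix c k assume c: "c \<in> atlas M"
  note M = smooth_inclusion_manifolds[OF assms(1)]
  have op: "open (snd c ` (V \<inter> fst c))"
    using assms(5) chart_openin[OF M(2) c] by (intro chart_image_of_open[OF M(2) c]) auto
  have "Ck_on k (snd c ` (V \<inter> fst c)) (\<lambda>x. \<phi> ((snd d \<circ> chart_inv c) x))"
  proof (rule Ck_on_compose[OF op assms(3)])
    show "Ck_on k P \<phi>" using assms(4) by (simp add: smooth_on_def)
    show "Ck_on k (snd c ` (V \<inter> fst c)) (snd d \<circ> chart_inv c)"
      using assms(6) by (intro Ck_on_subset[OF smooth_inclusion_Ck_on[OF assms(1) c assms(2)]]) auto
    show "(snd d \<circ> chart_inv c) x \<in> P" if "x \<in> snd c ` (V \<inter> fst c)" for x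
      using that assms(7) chart_inv_left[OF M(2) c] by auto
  qed
  then show "Ck_on k (snd c ` (V \<inter> fst c)) ((\<lambda>q. \<phi> (snd d q)) \<circ> chart_inv c)" by (simp add: comp_def)
qed

lemma Csmooth_chart_Ck_on:
  assumes "smooth_manifold M" "f \<in> Csmooth M" "c \<in> atlas M"
  shows "Ck_on k (snd c ` fst c) (f \<circ> chart_inv c)"
  using assms chart_subset_points[OF assms(1,3)]
  by (auto simp: Csmooth_def smooth_fun_on_def smooth_on_def Int_absorb1)

text \<open>Tangent vectors of \<open>M\<close> are \<open>0\<close> on functions outside \<open>Csmooth M\<close>. This inclusion is therefore
  what makes \<open>push N\<close> the differential of the inclusion and not \<open>0\<close>.\<close>

lemma Csmooth_subset:
  assumes "smooth_inclusion N M" shows "Csmooth N \<subseteq> Csmooth M"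
proof
  fix f assume f: "f \<in> Csmooth N"
  note M = smooth_inclusion_manifolds[OF assms(1)]
  have "smooth_fun_on M (points M) f"
  proof (rule smooth_fun_on_local[OF M(2)])
    fix p assume p: "p \<in> points M"
    then obtain d where d: "d \<in> atlas N" "p \<in> fst d"
      using assms M(1) by (auto simp: smooth_inclusion_def elim: chart_around)
    have op: "openin (mtop M) (points M \<inter> fst d)"
      by (rule smooth_inclusion_openin[OF assms chart_openin[OF M(1) d(1)]])
    have "smooth_on (snd d ` fst d) (f \<circ> chart_inv d)"
      unfolding smooth_on_def by (intro allI Csmooth_chart_Ck_on[OF M(1) f d(1)])
    then have "smooth_fun_on M (points M \<inter> fst d) (\<lambda>q. (f \<circ> chart_inv d) (snd d q))"
      by (rule smooth_fun_on_chart_expression[OF assms d(1) chart_image_open[OF M(1) d(1)] _ op]) auto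
    then have "smooth_fun_on M (points M \<inter> fst d) f"
      by (rule smooth_fun_on_cong[OF M(2) op]) (simp add: chart_inv_left[OF M(1) d(1)])
    then show "\<exists>V. openin (mtop M) V \<and> p \<in> V \<and> smooth_fun_on M V f" using op p d by blast
  qed
  then show "f \<in> Csmooth M" by (simp add: Csmooth_def)
qed

text \<open>A compact subset of a Hausdorff space is closed. Hence the complement of the preimage of the
  closed ball is open. The function is \<open>0\<close> there, and together with the chart domain it covers the
  manifold.\<close>

lemma Csmooth_extend_by_zero:
  assumes "smooth_manifold N" "d \<in> atlas N" "smooth_on (snd d ` fst d) \<phi>"
    and "cball y0 e \<subseteq> snd d ` fst d" "\<And>y. y \<notin> cball y0 e \<Longrightarrow> \<phi> y = 0"
  shows "(\<lambda>q. if q \<in> fst d then \<phi> (snd d q) else 0) \<in> Csmooth N"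
proof -
  define F where "F q = (if q \<in> fst d then \<phi> (snd d q) else 0)" for q
  define K where "K = chart_inv d ` cball y0 e"
  have "compactin (top_of_set (snd d ` fst d)) (cball y0 e)"
    using assms(4) by (simp add: compactin_subtopology)
  then have "compactin (mtop N) K"
    unfolding K_def by (rule image_compactin[OF _ chart_inv_continuous[OF assms(1,2)]])
  then have "closedin (mtop N) K"
    using assms(1) by (auto simp: smooth_manifold_def intro: compactin_imp_closedin)
  then have opK: "openin (mtop N) (points N - K)" by blast
  have FK: "F q = 0" if "q \<notin> K" for q
    using that assms(5) chart_inv_left[OF assms(1,2)] by (force simp: F_def K_def image_iff)
  have "smooth_fun_on N (points N) F"
  proof (rule smooth_fun_on_local[OF assms(1)])
    fix p assume p: "p \<in> points N"
    show "\<exists>V. openin (mtop N) V \<and> p \<in> V \<and> smooth_fun_on N V F"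
    proof (cases "p \<in> fst d")
      case True
      note op = chart_openin[OF assms(1,2)]
      have "smooth_fun_on N (fst d) (\<lambda>q. \<phi> (snd d q))"
        by (rule smooth_fun_on_chart_expression[OF smooth_inclusion_refl[OF assms(1)] assms(2) chart_image_open[OF assms(1,2)] assms(3) op]) auto
      then have "smooth_fun_on N (fst d) F"
        by (rule smooth_fun_on_cong[OF assms(1) op]) (simp add: F_def)
      then show ?thesis using True op by blast
    next
      case False
      have "K \<subseteq> fst d" using assms(4) chart_inv_left[OF assms(1,2)] by (force simp: K_def)
      then have "p \<in> points N - K" using p False by blast
      moreover have "smooth_fun_on N (points N - K) (\<lambda>q. 0)"
        by (auto simp: smooth_fun_on_def smooth_on_def comp_def)
      then have "smooth_fun_on N (points N - K) F"
        by (rule smooth_fun_on_cong[OF assms(1) opK]) (simp add: FK)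
      ultimately show ?thesis using opK by blast
    qed
  qed
  then show ?thesis by (simp add: Csmooth_def F_def[abs_def])
qed

section \<open>Tangent vectors and vector fields in charts\<close>

definition chart_vector :: "('a, 'e::euclidean_space) mfd \<Rightarrow> ('a, 'e) chart \<Rightarrow> 'a \<Rightarrow> 'e \<Rightarrow> 'a tangent" where
  "chart_vector M c p u = (\<lambda>f. if f \<in> Csmooth M then frechet_derivative (f \<circ> chart_inv c) (at (snd c p)) u else 0)"

lemma tangent_space_chart_vector:
  "tangent_space M p = {chart_vector M c p u | c u. c \<in> atlas M \<and> p \<in> fst c}"
  by (simp add: tangent_space_def chart_vector_def)

lemma chart_vector_in_tangent_space:
  "c \<in> atlas M \<Longrightarrow> p \<in> fst c \<Longrightarrow> chart_vector M c p u \<in> tangent_space M p"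
  unfolding tangent_space_chart_vector by blast

lemma tangent_spaceE:
  assumes "v \<in> tangent_space M p"
  obtains c u where "c \<in> atlas M" "p \<in> fst c" "v = chart_vector M c p u"
  using assms unfolding tangent_space_chart_vector by blast

text \<open>The chain rule for \<open>f \<circ> chart_inv c = (f \<circ> chart_inv d) \<circ> (snd d \<circ> chart_inv c)\<close>.\<close>

lemma push_chart_vector:
  assumes "smooth_inclusion N M" "c \<in> atlas M" "d \<in> atlas N" "q \<in> fst c" "q \<in> fst d"
  shows "push N (chart_vector M c q u) =
    chart_vector N d q (frechet_derivative (snd d \<circ> chart_inv c) (at (snd c q)) u)"
proof
  fix f
  note M = smooth_inclusion_manifolds[OF assms(1)]
  let ?S = "snd c ` (fst c \<inter> fst d)" and ?t = "snd d \<circ> chart_inv c"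
  show "push N (chart_vector M c q u) f = chart_vector N d q (frechet_derivative ?t (at (snd c q)) u) f"
  proof (cases "f \<in> Csmooth N")
    case True
    then have fM: "f \<in> Csmooth M" using Csmooth_subset[OF assms(1)] by blast
    have opS: "open ?S" and qS: "snd c q \<in> ?S"
      using chart_image_of_open[OF M(2) assms(2) charts_overlap_openin[OF assms(1,2,3)]] assms(4,5) by auto
    have tq: "?t (snd c q) = snd d q" using chart_inv_left[OF M(2) assms(2,4)] by simp
    have dt: "(?t has_derivative frechet_derivative ?t (at (snd c q))) (at (snd c q))"
      by (rule Ck_on_SucD[OF smooth_inclusion_Ck_on[OF assms(1,2,3)] qS])
    have df: "((f \<circ> chart_inv d) has_derivative frechet_derivative (f \<circ> chart_inv d) (at (?t (snd c q)))) (at (?t (snd c q)))"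
      unfolding tq using assms(5) by (intro Ck_on_SucD[OF Csmooth_chart_Ck_on[OF M(1) True assms(3)]]) auto
    have "((f \<circ> chart_inv c) has_derivative
      (\<lambda>u. frechet_derivative (f \<circ> chart_inv d) (at (snd d q)) (frechet_derivative ?t (at (snd c q)) u))) (at (snd c q))"
      using has_derivative_compose[OF dt df, unfolded tq] opS qS
    proof (rule has_derivative_transform_within_open)
      show "(f \<circ> chart_inv d) (?t x) = (f \<circ> chart_inv c) x" if "x \<in> ?S" for x
        using that chart_inv_left[OF M(2) assms(2)] chart_inv_left[OF M(1) assms(3)] by auto
    qed
    from fun_cong[OF frechet_derivative_at[OF this], of u] show ?thesis using True fM
      by (simp add: push_def chart_vector_def del: comp_apply)
  qed (simp add: push_def chart_vector_def)
qed

lemma push_tangent_in_chart: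
  assumes "smooth_inclusion N M" "v \<in> tangent_space M q" "d \<in> atlas N" "q \<in> fst d"
  obtains w where "push N v = chart_vector N d q w"
proof -
  obtain c u where c: "c \<in> atlas M" "q \<in> fst c" and v: "v = chart_vector M c q u"
    by (rule tangent_spaceE[OF assms(2)])
  show ?thesis by (rule that) (unfold v, rule push_chart_vector[OF assms(1) c(1) assms(3) c(2) assms(4)])
qed

lemma tangent_in_subset:
  assumes "smooth_inclusion N M" shows "tangent_in N M q \<subseteq> tangent_space N q"
proof
  fix w assume "w \<in> tangent_in N M q"
  then obtain v where v: "v \<in> tangent_space M q" "w = push N v" by (auto simp: tangent_in_def)
  note M = smooth_inclusion_manifolds[OF assms(1)]
  have "q \<in> points M" using v(1) chart_subset_points[OF M(2)] by (blast elim: tangent_spaceE)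
  then obtain d where d: "d \<in> atlas N" "q \<in> fst d"
    using assms M(1) by (auto simp: smooth_inclusion_def elim: chart_around)
  obtain u where "push N v = chart_vector N d q u" by (rule push_tangent_in_chart[OF assms v(1) d])
  then show "w \<in> tangent_space N q" using d v(2) by (simp add: chart_vector_in_tangent_space)
qed

lemma tangent_vector_local:
  assumes "smooth_manifold M" "v \<in> tangent_space M p" "f \<in> Csmooth M" "h \<in> Csmooth M"
    and "openin (mtop M) V" "p \<in> V" "\<And>q. q \<in> V \<Longrightarrow> f q = h q"
  shows "v f = v h"
proof -
  obtain c u where c: "c \<in> atlas M" "p \<in> fst c" "v = chart_vector M c p u"
    by (rule tangent_spaceE[OF assms(2)])
  have "frechet_derivative (f \<circ> chart_inv c) (at (snd c p)) = frechet_derivative (h \<circ> chart_inv c) (at (snd c p))"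
  proof (rule frechet_derivative_transform_within_open)
    have "Ck_on 1 (snd c ` fst c) (f \<circ> chart_inv c)" by (rule Csmooth_chart_Ck_on[OF assms(1,3) c(1)])
    then show "(f \<circ> chart_inv c) differentiable (at (snd c p))" using c(2) by simp
    show "open (snd c ` (V \<inter> fst c))"
      using assms(5) chart_openin[OF assms(1) c(1)] by (intro chart_image_of_open[OF assms(1) c(1)]) auto
    show "snd c p \<in> snd c ` (V \<inter> fst c)" using c assms(6) by blast
    show "(f \<circ> chart_inv c) x = (h \<circ> chart_inv c) x" if "x \<in> snd c ` (V \<inter> fst c)" for x
      using that assms(7) chart_inv_left[OF assms(1) c(1)] by auto
  qed
  then show ?thesis using assms(3,4) c(3) by (simp add: chart_vector_def)
qed

text \<open>Applied to a function \<open>f\<close>, the field is the extension by zero of \<open>y \<mapsto> (f \<circ> chart_inv d)' y (W y)\<close>,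
  so smoothness reduces to \<open>Csmooth_extend_by_zero\<close>.\<close>

lemma vector_field_extend_by_zero:
  fixes N :: "('a, 'e::euclidean_space) mfd"
  assumes "smooth_manifold N" "d \<in> atlas N" "smooth_on (snd d ` fst d) W"
    and "cball y0 e \<subseteq> snd d ` fst d" "\<And>y. y \<notin> cball y0 e \<Longrightarrow> W y = 0"
  shows "(\<lambda>q. if q \<in> fst d then chart_vector N d q (W (snd d q)) else 0) \<in> vector_fields N"
proof -
  define Z where "Z q = (if q \<in> fst d then chart_vector N d q (W (snd d q)) else 0)" for q
  have lin: "linear (frechet_derivative (f \<circ> chart_inv c) (at (snd c q)))"
    if "f \<in> Csmooth N" "c \<in> atlas N" "q \<in> fst c" for f c q
    using Ck_on_SucD[OF Csmooth_chart_Ck_on[OF assms(1) that(1,2)]] that(3)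
    by (blast intro: has_derivative_linear)
  have "Z q \<in> tangent_space N q" if q: "q \<in> points N" for q
  proof (cases "q \<in> fst d")
    case True
    then show ?thesis using assms(2) by (simp add: Z_def chart_vector_in_tangent_space)
  next
    case False
    obtain c where c: "c \<in> atlas N" "q \<in> fst c" using chart_around[OF assms(1) q] .
    \<comment> \<open>outside the chart domain the value is the zero vector, expressed in some other chart\<close>
    have "Z q = chart_vector N c q 0"
      using False lin[OF _ c] by (auto simp: Z_def chart_vector_def linear_0)
    then show ?thesis using c by (simp add: chart_vector_in_tangent_space)
  qed
  moreover have "smooth_fun_on N (points N) (\<lambda>q. Z q f)" if f: "f \<in> Csmooth N" for f
  proof -
    let ?D = "\<lambda>y. frechet_derivative (f \<circ> chart_inv d) (at y)"
    note df = Ck_on_SucD[OF Csmooth_chart_Ck_on[OF assms(1) f assms(2)]]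
    have Dk: "Ck_on k (snd d ` fst d) (\<lambda>y. ?D y v)" for k v
      using Csmooth_chart_Ck_on[OF assms(1) f assms(2), of "Suc k"] by simp
    have "smooth_on (snd d ` fst d) (\<lambda>y. \<Sum>b\<in>Basis. (W y \<bullet> b) *\<^sub>R ?D y b)"
      unfolding smooth_on_def using assms(3) chart_image_open[OF assms(1,2)]
      by (intro allI Ck_on_sum Ck_on_bilinear[OF bounded_bilinear_scaleR] Ck_on_inner_const Dk)
         (auto simp: smooth_on_def)
    then have "(\<lambda>q. if q \<in> fst d then \<Sum>b\<in>Basis. (W (snd d q) \<bullet> b) *\<^sub>R ?D (snd d q) b else 0) \<in> Csmooth N"
      by (rule Csmooth_extend_by_zero[OF assms(1,2) _ assms(4)]) (simp add: assms(5))
    moreover have "(\<Sum>b\<in>Basis. (W (snd d q) \<bullet> b) *\<^sub>R ?D (snd d q) b) = ?D (snd d q) (W (snd d q))" if "q \<in> fst d" for q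
      using that by (intro derivative_euclidean_expansion[OF df, symmetric]) auto
    ultimately have "(\<lambda>q. if q \<in> fst d then ?D (snd d q) (W (snd d q)) else 0) \<in> Csmooth N"
      by (simp cong: if_cong)
    then have "(\<lambda>q. Z q f) \<in> Csmooth N"
      by (rule back_subst[of "\<lambda>F. F \<in> Csmooth N"]) (auto simp: Z_def chart_vector_def f)
    then show ?thesis by (simp add: Csmooth_def)
  qed
  moreover have "Z q = 0" if "q \<notin> points N" for q
    using that chart_subset_points[OF assms(1,2)] by (auto simp: Z_def)
  ultimately show ?thesis by (simp add: vector_fields_def smooth_along_def Z_def[abs_def])
qed

text \<open>Tangent vectors act on global functions only; the coordinates of the chart, cut off by a bump
  function, become global functions that still detect the components of a vector near the centre.\<close>

lemma chart_coordinate_functions: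
  fixes N :: "('a, 'e::euclidean_space) mfd"
  assumes "smooth_manifold N" "d \<in> atlas N" "e > 0" "cball y0 (2 * e) \<subseteq> snd d ` fst d"
  obtains F where "\<And>b. F b \<in> Csmooth N"
    "\<And>b q w. q \<in> fst d \<Longrightarrow> dist y0 (snd d q) < e \<Longrightarrow> chart_vector N d q w (F b) = w \<bullet> b"
proof -
  obtain \<beta> :: "'e \<Rightarrow> real" where \<beta>: "smooth_on UNIV \<beta>" "\<And>y. dist y0 y < e \<Longrightarrow> \<beta> y = 1"
    "\<And>y. dist y0 y \<ge> 2 * e \<Longrightarrow> \<beta> y = 0"
    using smooth_bump_function[OF assms(3)] by blast
  define F where "F b q = (if q \<in> fst d then \<beta> (snd d q) * (snd d q \<bullet> b) else 0)" for b q
  have "smooth_on (snd d ` fst d) (\<lambda>y. \<beta> y * (y \<bullet> b))" for b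
    unfolding smooth_on_def
  proof
    fix k
    have "Ck_on k UNIV (\<lambda>y. \<beta> y * (y \<bullet> b))"
      using \<beta>(1) by (intro Ck_on_bilinear[OF bounded_bilinear_mult] Ck_on_inner_const
          Ck_on_linear[OF bounded_linear_ident]) (auto simp: smooth_on_def)
    then show "Ck_on k (snd d ` fst d) (\<lambda>y. \<beta> y * (y \<bullet> b))" by (rule Ck_on_subset) simp
  qed
  then have F: "F b \<in> Csmooth N" for b
    unfolding F_def by (rule Csmooth_extend_by_zero[OF assms(1,2) _ assms(4)]) (simp add: \<beta>(3))
  have "chart_vector N d q w (F b) = w \<bullet> b" if q: "q \<in> fst d" "dist y0 (snd d q) < e" for b q w
  proof -
    have "((F b \<circ> chart_inv d) has_derivative (\<lambda>w. w \<bullet> b)) (at (snd d q))"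
    proof (rule has_derivative_transform_within_open[of "\<lambda>y. y \<bullet> b"])
      show "((\<lambda>y. y \<bullet> b) has_derivative (\<lambda>w. w \<bullet> b)) (at (snd d q))"
        by (rule bounded_linear_imp_has_derivative[OF bounded_linear_inner_left])
      show "open (ball y0 e)" "snd d q \<in> ball y0 e" using q by auto
      fix y assume y: "y \<in> ball y0 e"
      then have "y \<in> cball y0 (2 * e)" using assms(3) by auto
      then obtain q' where "q' \<in> fst d" "y = snd d q'" using assms(4) by blast
      then show "y \<bullet> b = (F b \<circ> chart_inv d) y"
        using y \<beta>(2) chart_inv_left[OF assms(1,2)] by (simp add: F_def)
    qed
    then show ?thesis using F by (simp add: chart_vector_def frechet_derivative_at[symmetric])
  qed
  with F show ?thesis by (rule that)
qed

section \<open>Extension of vector fields from a submanifold\<close>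

text \<open>In charts \<open>c\<close> of \<open>M\<close> and \<open>d\<close> of \<open>N\<close> the inclusion is an immersion with a smooth local left
  inverse \<open>\<pi>\<close>. The components of \<open>X\<close> with respect to \<open>d\<close> are the smooth functions \<open>X q (F b)\<close> on \<open>M\<close>,
  where \<open>F b\<close> are the cut off coordinates. Their compositions with \<open>\<pi>\<close>, multiplied by a bump function,
  are the components of a field on \<open>N\<close> that agrees with \<open>X\<close> near \<open>p\<close> on \<open>M\<close>.\<close>

lemma vector_field_local_extension:
  fixes N :: "('a, 'e::euclidean_space) mfd" and M :: "('a, 'm::euclidean_space) mfd"
  assumes N: "smooth_manifold N" and sub: "submanifold N M" and X: "X \<in> vector_fields M" and p: "p \<in> points M"
  obtains Z where "extends_near N M p X Z"
proof -
  have incl: "smooth_inclusion N M" using smooth_inclusion_submanifold N sub .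
  note M = smooth_inclusion_manifolds(2)[OF incl]
  obtain c where c: "c \<in> atlas M" "p \<in> fst c" using chart_around[OF M p] .
  obtain d where d: "d \<in> atlas N" "p \<in> fst d"
    using p sub N by (auto simp: submanifold_def elim: chart_around)
  let ?S = "snd c ` (fst c \<inter> fst d)" and ?t = "snd d \<circ> chart_inv c"
  have opS: "open ?S" and pS: "snd c p \<in> ?S"
    using chart_image_of_open[OF M c(1) charts_overlap_openin[OF incl c(1) d(1)]] c d by auto
  have "smooth_on ?S ?t" using smooth_inclusion_Ck_on[OF incl c(1) d(1)] by (simp add: smooth_on_def)
  moreover have "inj (frechet_derivative ?t (at (snd c p)))" using sub c d by (auto simp: submanifold_def)
  ultimately obtain U' P \<pi> where \<pi>: "open U'" "snd c p \<in> U'" "U' \<subseteq> ?S" "open P" "smooth_on P \<pi>"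
    "\<And>y. y \<in> P \<Longrightarrow> \<pi> y \<in> U'" "\<And>x. x \<in> U' \<Longrightarrow> ?t x \<in> P" "\<And>x. x \<in> U' \<Longrightarrow> \<pi> (?t x) = x"
    using smooth_immersion_left_inverse[OF opS _ pS] by metis
  define y0 where "y0 = snd d p"
  define Q where "Q = P \<inter> snd d ` fst d"
  have opQ: "open Q" using \<pi>(4) chart_image_open[OF N d(1)] by (auto simp: Q_def)
  have "y0 \<in> Q"
    using \<pi>(7)[OF \<pi>(2)] d(2) chart_inv_left[OF M c] by (auto simp: Q_def y0_def)
  then obtain e' where "e' > 0" "cball y0 e' \<subseteq> Q" using opQ open_contains_cball by blast
  then obtain e where e: "e > 0" "cball y0 (2 * e) \<subseteq> Q"
    by (metis field_sum_of_halves half_gt_zero mult_2)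
  obtain \<beta> :: "'e \<Rightarrow> real" where \<beta>: "smooth_on UNIV \<beta>" "\<And>y. dist y0 y < e \<Longrightarrow> \<beta> y = 1"
    "\<And>y. dist y0 y \<ge> 2 * e \<Longrightarrow> \<beta> y = 0"
    using smooth_bump_function[OF e(1)] by blast
  obtain F where F: "\<And>b. F b \<in> Csmooth N"
    "\<And>b q w. q \<in> fst d \<Longrightarrow> dist y0 (snd d q) < e \<Longrightarrow> chart_vector N d q w (F b) = w \<bullet> b"
    using chart_coordinate_functions[OF N d(1) e(1)] e(2) by (auto simp: Q_def)
  have XF: "Ck_on k (snd c ` fst c) (\<lambda>x. X (chart_inv c x) (F b))" for k b
  proof -
    have "(\<lambda>q. X q (F b)) \<in> Csmooth M"
      using X F(1) Csmooth_subset[OF incl] by (auto simp: vector_fields_def smooth_along_def Csmooth_def)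
    then show ?thesis using Csmooth_chart_Ck_on[OF M _ c(1)] by (force simp: comp_def)
  qed
  define h where "h y = (\<Sum>b\<in>Basis. X (chart_inv c (\<pi> y)) (F b) *\<^sub>R b)" for y
  have hk: "Ck_on k Q h" for k
  proof -
    have "Ck_on k Q \<pi>" using \<pi>(5) by (auto simp: smooth_on_def Q_def intro: Ck_on_subset)
    then have "Ck_on k Q (\<lambda>y. X (chart_inv c (\<pi> y)) (F b))" for b
      by (rule Ck_on_compose[OF opQ chart_image_open[OF M c(1)] XF]) (use \<pi>(3,6) in \<open>auto simp: Q_def\<close>)
    then show ?thesis
      unfolding h_def by (intro Ck_on_sum Ck_on_bilinear[OF bounded_bilinear_scaleR] opQ Ck_on_const)
  qed
  define W where "W y = (if y \<in> Q then \<beta> y *\<^sub>R h y else 0)" for y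
  have "Ck_on k UNIV W" for k
    unfolding W_def using \<beta>(1,3) by (intro Ck_on_cutoff[OF opQ hk _ e(2)]) (auto simp: smooth_on_def)
  then have "smooth_on (snd d ` fst d) W" unfolding smooth_on_def by (auto intro: Ck_on_subset)
  moreover have "W y = 0" if "y \<notin> cball y0 (2 * e)" for y using that \<beta>(3)[of y] by (simp add: W_def)
  moreover have "cball y0 (2 * e) \<subseteq> snd d ` fst d" using e(2) by (auto simp: Q_def)
  ultimately have Z: "(\<lambda>q. if q \<in> fst d then chart_vector N d q (W (snd d q)) else 0) \<in> vector_fields N" (is "?Z \<in> _")
    by (intro vector_field_extend_by_zero[OF N d(1)])
  \<comment> \<open>\<open>\<pi>\<close> inverts the inclusion where \<open>snd c q \<in> U'\<close>; the bump functions are \<open>1\<close> on the ball of radius \<open>e\<close>\<close>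
  let ?V = "{q \<in> fst c. snd c q \<in> U'} \<inter> (points M \<inter> {q \<in> fst d. snd d q \<in> ball y0 e})"
  have "openin (mtop M) ?V"
    using chart_preimage_openin[OF M c(1) \<pi>(1)]
      smooth_inclusion_openin[OF incl chart_preimage_openin[OF N d(1) open_ball, of y0 e]]
    by (rule openin_Int)
  moreover have "p \<in> ?V" using p c d \<pi>(2) e(1) by (simp add: y0_def)
  moreover have "?Z q = push N (X q)" if "q \<in> ?V" for q
  proof -
    from that have q: "q \<in> fst c" "snd c q \<in> U'" "q \<in> points M" "q \<in> fst d" "dist y0 (snd d q) < e" by auto
    have tq: "?t (snd c q) = snd d q" using chart_inv_left[OF M c(1) q(1)] by simp
    have \<pi>q: "\<pi> (snd d q) = snd c q" using \<pi>(8)[OF q(2)] tq by simp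
    have "snd d q \<in> Q" using \<pi>(7)[OF q(2)] tq q(4) by (auto simp: Q_def)
    then have Wq: "W (snd d q) = (\<Sum>b\<in>Basis. X q (F b) *\<^sub>R b)"
      using \<beta>(2)[OF q(5)] chart_inv_left[OF M c(1) q(1)] by (simp add: W_def h_def \<pi>q)
    have "X q \<in> tangent_space M q" using X q(3) by (simp add: vector_fields_def smooth_along_def)
    then obtain w where w: "push N (X q) = chart_vector N d q w" using push_tangent_in_chart[OF incl _ d(1) q(4)] by blast
    have "X q (F b) = w \<bullet> b" for b
      using F(2)[OF q(4,5), of w b] F(1)[of b] by (simp add: w[symmetric] push_def)
    then have "W (snd d q) = w" by (simp add: Wq euclidean_representation)
    then show ?thesis using q(4) w by simp
  qed
  ultimately have "extends_near N M p X ?Z" using Z unfolding extends_near_def by blast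
  then show ?thesis by (rule that)
qed

section \<open>The induced metric and the induced connections\<close>

lemma pairing_extension:
  assumes "extends_near N M p Y Y'" "extends_near N M p Z Z'"
  obtains U where "openin (mtop M) U" "p \<in> U"
    "\<forall>q\<in>U. pairing (induced_metric N g) Y Z q = pairing g Y' Z' q"
proof -
  obtain U V where "openin (mtop M) U" "p \<in> U" "\<And>q. q \<in> U \<Longrightarrow> Y' q = push N (Y q)"
    and "openin (mtop M) V" "p \<in> V" "\<And>q. q \<in> V \<Longrightarrow> Z' q = push N (Z q)"
    using assms unfolding extends_near_def by metis
  then show ?thesis
    by (intro that[of "U \<inter> V"]) (auto simp: pairing_def induced_metric_def)
qed

text \<open>Tangent vectors of \<open>M\<close> are \<open>0\<close> on functions outside \<open>Csmooth M\<close>. Hence this membership is what makes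
  the derivative of the induced metric along a vector field the true one. It holds because the
  function agrees near each point with a smooth function on \<open>N\<close>.\<close>

lemma induced_pairing_Csmooth:
  assumes "submanifold N M" "smooth_manifold N" "semi_riemannian_metric N q g"
    and Y: "Y \<in> vector_fields M" and Z: "Z \<in> vector_fields M"
  shows "pairing (induced_metric N g) Y Z \<in> Csmooth M"
proof -
  have incl: "smooth_inclusion N M" using assms by (intro smooth_inclusion_submanifold)
  note M = smooth_inclusion_manifolds(2)[OF incl]
  have "smooth_fun_on M (points M) (pairing (induced_metric N g) Y Z)"
  proof (rule smooth_fun_on_local[OF M])
    fix p assume p: "p \<in> points M"
    obtain Y' Z' where ext: "extends_near N M p Y Y'" "extends_near N M p Z Z'"
      using vector_field_local_extension[OF assms(2,1) _ p] Y Z by metis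
    obtain U where U: "openin (mtop M) U" "p \<in> U"
      "\<forall>q\<in>U. pairing (induced_metric N g) Y Z q = pairing g Y' Z' q"
      by (rule pairing_extension[OF ext, of g])
    have "pairing g Y' Z' \<in> Csmooth M"
      using ext assms(3) Csmooth_subset[OF incl] by (auto simp: extends_near_def semi_riemannian_metric_def)
    then have "smooth_fun_on M U (pairing g Y' Z')"
      using openin_subset[OF U(1)]
      by (auto simp: Csmooth_def smooth_fun_on_def smooth_on_def intro: Ck_on_subset[OF _ image_mono])
    then have "smooth_fun_on M U (pairing (induced_metric N g) Y Z)"
      by (rule smooth_fun_on_cong[OF M U(1)]) (simp add: U(3))
    then show "\<exists>V. openin (mtop M) V \<and> p \<in> V \<and> smooth_fun_on M V (pairing (induced_metric N g) Y Z)"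
      using U by blast
  qed
  then show ?thesis by (simp add: Csmooth_def)
qed

text \<open>The functions \<open>g(Y, Z)\<close> on \<open>M\<close> and \<open>g(Y', Z')\<close> on \<open>N\<close> agree on a neighbourhood of \<open>p\<close> in \<open>M\<close>, and
  \<open>X' p\<close> is the image of \<open>X p\<close>.\<close>

lemma field_app_induced_pairing:
  assumes "submanifold N M" "smooth_manifold N" "semi_riemannian_metric N q g"
    and "X \<in> vector_fields M" "Y \<in> vector_fields M" "Z \<in> vector_fields M" "p \<in> points M"
    and ext: "extends_near N M p X X'" "extends_near N M p Y Y'" "extends_near N M p Z Z'"
  shows "field_app X (pairing (induced_metric N g) Y Z) p = field_app X' (pairing g Y' Z') p"
proof -
  have incl: "smooth_inclusion N M" using assms by (intro smooth_inclusion_submanifold)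
  note M = smooth_inclusion_manifolds(2)[OF incl]
  obtain U where U: "openin (mtop M) U" "p \<in> U"
    "\<forall>q\<in>U. pairing (induced_metric N g) Y Z q = pairing g Y' Z' q"
    by (rule pairing_extension[OF ext(2,3), of g])
  have N: "pairing g Y' Z' \<in> Csmooth N"
    using ext assms(3) by (auto simp: extends_near_def semi_riemannian_metric_def)
  then have "pairing g Y' Z' \<in> Csmooth M" using Csmooth_subset[OF incl] by blast
  moreover have "X p \<in> tangent_space M p"
    using assms(4,7) by (simp add: vector_fields_def smooth_along_def)
  ultimately have "X p (pairing (induced_metric N g) Y Z) = X p (pairing g Y' Z')"
    using tangent_vector_local[OF M _ induced_pairing_Csmooth[OF assms(1-3,5,6)] _ U(1,2)] U(3) by blast
  also have "\<dots> = X' p (pairing g Y' Z')"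
    using ext(1) N by (auto simp: extends_near_def push_def)
  finally show ?thesis by (simp add: field_app_def)
qed

lemma screen_transversal_subset_normal:
  assumes "screen_transversal_bundle N g r M S'" "p \<in> points M"
  shows "S' p \<subseteq> normal_in N g M p"
proof
  fix w assume w: "w \<in> S' p"
  have c: "complementary (normal_in N g M p) (rad N g M p) (S' p)"
    using assms by (simp add: screen_transversal_bundle_def)
  then have "0 \<in> rad N g M p" unfolding complementary_def by blast
  then have "0 + w \<in> normal_in N g M p" using c w unfolding complementary_def by blast
  then show "w \<in> normal_in N g M p" by simp
qed

text \<open>The part of \<open>D X' Y'\<close> in the screen transversal bundle is orthogonal to \<open>M\<close>,
  and the part in the lightlike transversal bundle, the only one that pairs nontrivially with the
  radical of \<open>M\<close>, is \<open>0\<close> by assumption. So the metric sees only the induced connection.\<close>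

lemma metric_tangential_part:
  assumes incl: "smooth_inclusion N M" and g: "semi_riemannian_metric N q g" and D: "affine_connection N D"
    and S': "screen_transversal_bundle N g r M S'"
    and gauss: "gauss_decomposition N M L S' D C hl hs" and hl: "vanishes_identically M hl"
    and X: "X \<in> vector_fields M" and Y: "Y \<in> vector_fields M" and p: "p \<in> points M"
    and ext: "extends_near N M p X X'" "extends_near N M p Y Y'"
    and v: "v \<in> tangent_space M p"
  shows "g p (D X' Y' p) (push N v) = induced_metric N g p (C X Y p) v"
    and "g p (push N v) (D X' Y' p) = induced_metric N g p v (C X Y p)"
proof -
  have C: "C X Y p \<in> tangent_space M p"
    using gauss X Y p by (simp add: gauss_decomposition_def vector_fields_def smooth_along_def)
  have tan: "push N w \<in> tangent_in N M p" "push N w \<in> tangent_space N p" if "w \<in> tangent_space M p" for w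
    using that tangent_in_subset[OF incl] by (auto simp: tangent_in_def)
  have pN: "p \<in> points N" using incl p by (auto simp: smooth_inclusion_def)
  have sym: "g p u w = g p w u" if "u \<in> tangent_space N p" "w \<in> tangent_space N p" for u w
    using g pN that by (simp add: semi_riemannian_metric_def symmetric_bilinear_on_def)
  have lin: "g p (a *\<^sub>R u + b *\<^sub>R u') w = a * g p u w + b * g p u' w"
    if "u \<in> tangent_space N p" "u' \<in> tangent_space N p" "w \<in> tangent_space N p" for u u' w a b
    using g pN that by (simp add: semi_riemannian_metric_def symmetric_bilinear_on_def)
  have hs: "hs X Y p \<in> normal_in N g M p"
    using gauss X Y p screen_transversal_subset_normal[OF S' p] by (auto simp: gauss_decomposition_def)
  then have hsN: "hs X Y p \<in> tangent_space N p" and orth: "g p (push N v) (hs X Y p) = 0"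
    using tan[OF v] by (auto simp: normal_in_def)
  have "D X' Y' p = push N (C X Y p) + hl X Y p + hs X Y p"
    using gauss X Y p ext by (simp add: gauss_decomposition_def)
  also have "hl X Y p = 0" using hl X Y p by (simp add: vanishes_identically_def)
  finally have split: "D X' Y' p = 1 *\<^sub>R push N (C X Y p) + 1 *\<^sub>R hs X Y p"
    by (simp only: scaleR_one add_0_right)
  show 1: "g p (D X' Y' p) (push N v) = induced_metric N g p (C X Y p) v"
    unfolding split using lin[OF tan(2)[OF C] hsN tan(2)[OF v], of 1 1] orth sym[OF tan(2)[OF v] hsN]
    by (simp add: induced_metric_def)
  have "D X' Y' p \<in> tangent_space N p"
    using D ext pN by (auto simp: affine_connection_def extends_near_def vector_fields_def smooth_along_def)
  then show "g p (push N v) (D X' Y' p) = induced_metric N g p v (C X Y p)"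
    using 1 sym[OF tan(2)[OF v]] sym[OF tan(2)[OF v] tan(2)[OF C]] by (simp add: induced_metric_def)
qed

lemma dual_connection_induced:
  assumes "submanifold N M" "smooth_manifold N" "semi_riemannian_metric N q g"
    and "affine_connection N D" "affine_connection N D'" "dual_connection N g D D'"
    and "screen_transversal_bundle N g r M S'"
    and "gauss_decomposition N M L S' D C hl hs" "vanishes_identically M hl"
    and "gauss_decomposition N M L S' D' C' hl' hs'" "vanishes_identically M hl'"
  shows "dual_connection M (induced_metric N g) C C'"
  unfolding dual_connection_def
proof (intro ballI)
  fix X Y Z p
  assume XYZ: "X \<in> vector_fields M" "Y \<in> vector_fields M" "Z \<in> vector_fields M" and p: "p \<in> points M"
  have incl: "smooth_inclusion N M" using assms by (intro smooth_inclusion_submanifold)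
  obtain X' Y' Z' where ext: "extends_near N M p X X'" "extends_near N M p Y Y'" "extends_near N M p Z Z'"
    using vector_field_local_extension[OF assms(2,1) _ p] XYZ by metis
  have at_p: "Y' p = push N (Y p)" "Z' p = push N (Z p)" using ext by (auto simp: extends_near_def)
  have tan: "Y p \<in> tangent_space M p" "Z p \<in> tangent_space M p"
    using XYZ p by (auto simp: vector_fields_def smooth_along_def)
  have pN: "p \<in> points N" using incl p by (auto simp: smooth_inclusion_def)
  have "field_app X (pairing (induced_metric N g) Y Z) p = field_app X' (pairing g Y' Z') p"
    by (rule field_app_induced_pairing[OF assms(1-3) XYZ p ext])
  also have "\<dots> = pairing g (D X' Y') Z' p + pairing g Y' (D' X' Z') p"
    using assms(6) ext pN by (auto simp: dual_connection_def extends_near_def)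
  also have "pairing g (D X' Y') Z' p = pairing (induced_metric N g) (C X Y) Z p"
    using metric_tangential_part(1)[OF incl assms(3,4,7,8,9) XYZ(1,2) p ext(1,2) tan(2)]
    by (simp add: pairing_def at_p)
  also have "pairing g Y' (D' X' Z') p = pairing (induced_metric N g) Y (C' X Z) p"
    using metric_tangential_part(2)[OF incl assms(3,5,7,10,11) XYZ(1,3) p ext(1,3) tan(1)]
    by (simp add: pairing_def at_p)
  finally show "field_app X (pairing (induced_metric N g) Y Z) p =
      pairing (induced_metric N g) (C X Y) Z p + pairing (induced_metric N g) Y (C' X Z) p" .
qed

lemma codazzi_induced:
  assumes "submanifold N M" "smooth_manifold N" "semi_riemannian_metric N q g"
    and "affine_connection N D" "codazzi N g D"
    and "screen_transversal_bundle N g r M S'"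
    and "gauss_decomposition N M L S' D C hl hs" "vanishes_identically M hl"
  shows "codazzi M (induced_metric N g) C"
  unfolding codazzi_def
proof (intro ballI)
  fix X Y Z p
  assume XYZ: "X \<in> vector_fields M" "Y \<in> vector_fields M" "Z \<in> vector_fields M" and p: "p \<in> points M"
  have incl: "smooth_inclusion N M" using assms by (intro smooth_inclusion_submanifold)
  obtain X' Y' Z' where ext: "extends_near N M p X X'" "extends_near N M p Y Y'" "extends_near N M p Z Z'"
    using vector_field_local_extension[OF assms(2,1) _ p] XYZ by metis
  have pN: "p \<in> points N" using incl p by (auto simp: smooth_inclusion_def)
  have eq: "metric_deriv (induced_metric N g) C A B Z p = metric_deriv g D A' B' Z' p"
    if A: "A \<in> vector_fields M" "extends_near N M p A A'" and B: "B \<in> vector_fields M" "extends_near N M p B B'"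
    for A A' B B'
  proof -
    have at_p: "B' p = push N (B p)" "Z' p = push N (Z p)" using B ext by (auto simp: extends_near_def)
    have tan: "B p \<in> tangent_space M p" "Z p \<in> tangent_space M p"
      using B XYZ p by (auto simp: vector_fields_def smooth_along_def)
    have "field_app A (pairing (induced_metric N g) B Z) p = field_app A' (pairing g B' Z') p"
      by (rule field_app_induced_pairing[OF assms(1-3) A(1) B(1) XYZ(3) p A(2) B(2) ext(3)])
    moreover have "pairing g (D A' B') Z' p = pairing (induced_metric N g) (C A B) Z p"
      using metric_tangential_part(1)[OF incl assms(3,4,6,7,8) A(1) B(1) p A(2) B(2) tan(2)]
      by (simp add: pairing_def at_p)
    moreover have "pairing g B' (D A' Z') p = pairing (induced_metric N g) B (C A Z) p"
      using metric_tangential_part(2)[OF incl assms(3,4,6,7,8) A(1) XYZ(3) p A(2) ext(3) tan(1)]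
      by (simp add: pairing_def at_p)
    ultimately show ?thesis by (simp add: metric_deriv_def)
  qed
  have "metric_deriv g D X' Y' Z' p = metric_deriv g D Y' X' Z' p"
    using assms(5) ext pN by (auto simp: codazzi_def extends_near_def)
  then show "metric_deriv (induced_metric N g) C X Y Z p = metric_deriv (induced_metric N g) C Y X Z p"
    using eq[OF XYZ(1) ext(1) XYZ(2) ext(2)] eq[OF XYZ(2) ext(2) XYZ(1) ext(1)] by simp
qed

text \<open>Duality of \<open>D\<close> and \<open>D'\<close>, used for \<open>(Y, Z)\<close> and for \<open>(Z, Y)\<close>, gives
  \<open>(D'\<^sub>X g)(Y, Z) = - (D\<^sub>X g)(Y, Z)\<close>.\<close>

lemma codazzi_dual:
  assumes "semi_riemannian_metric N q g" "affine_connection N D" "codazzi N g D" "affine_connection N D'"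
    and "dual_connection N g D D'"
  shows "codazzi N g D'"
  unfolding codazzi_def
proof (intro ballI)
  fix X Y Z p
  assume XYZ: "X \<in> vector_fields N" "Y \<in> vector_fields N" "Z \<in> vector_fields N" and p: "p \<in> points N"
  \<comment> \<open>The equality is needed for the functions, not only at \<open>p\<close>, because they get differentiated. Off the
    manifold, where \<open>g\<close> is arbitrary, it holds because vector fields vanish there.\<close>
  have sym: "pairing g A B = pairing g B A" if "A \<in> vector_fields N" "B \<in> vector_fields N" for A B
  proof
    fix q
    show "pairing g A B q = pairing g B A q"
    proof (cases "q \<in> points N")
      case True
      then show ?thesis using assms(1) that
        by (simp add: semi_riemannian_metric_def symmetric_bilinear_on_def pairing_def vector_fields_def smooth_along_def)
    next
      case False
      then show ?thesis using that by (simp add: pairing_def vector_fields_def)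
    qed
  qed
  have skew: "metric_deriv g D' A B Z p = - metric_deriv g D A B Z p"
    if A: "A \<in> vector_fields N" and B: "B \<in> vector_fields N" for A B
  proof -
    have vf: "D A B \<in> vector_fields N" "D A Z \<in> vector_fields N" "D' A B \<in> vector_fields N" "D' A Z \<in> vector_fields N"
      using assms(2,4) A B XYZ(3) by (auto simp: affine_connection_def)
    have "field_app A (pairing g B Z) p = pairing g (D A B) Z p + pairing g B (D' A Z) p"
      "field_app A (pairing g Z B) p = pairing g (D A Z) B p + pairing g Z (D' A B) p"
      using assms(5) A B XYZ(3) p by (auto simp: dual_connection_def)
    then show ?thesis
      using sym[OF B XYZ(3)] sym[OF B vf(2)] sym[OF XYZ(3) vf(3)] by (simp add: metric_deriv_def)
  qed
  show "metric_deriv g D' X Y Z p = metric_deriv g D' Y X Z p"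
    using assms(3) XYZ p by (simp add: skew codazzi_def)
qed

theorem theorem3p5:
  fixes N :: "('a, 'e::euclidean_space) mfd" and M :: "('a, 'm::euclidean_space) mfd"
    and q r :: nat and g :: "'a metric_field"
    and D D' C C' hl hl' hs hs' :: "'a connection"
    and S S' L :: "'a \<Rightarrow> 'a tangent set"
  assumes "indefinite_statistical_manifold N q g D D'"
    and "lightlike_submanifold N g r M"
    and "screen_distribution N g r M S"
    and "screen_transversal_bundle N g r M S'"
    and "lightlike_transversal_bundle N g r M S S' L"
    and "gauss_decomposition N M L S' D C hl hs"
    and "gauss_decomposition N M L S' D' C' hl' hs'"
    and "vanishes_identically M hl"
    and "vanishes_identically M hl'"
  shows "lightlike_statistical_submanifold N g r M C \<and>
    lightlike_statistical_submanifold N g r M C' \<and>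
    dual_connection M (induced_metric N g) C C'"
proof -
  have N: "smooth_manifold N" "semi_riemannian_metric N q g" "affine_connection N D" "codazzi N g D"
    "affine_connection N D'" "dual_connection N g D D'"
    using assms(1) unfolding indefinite_statistical_manifold_def by blast+
  have M: "submanifold N M" using assms(2) unfolding lightlike_submanifold_def by blast
  have D': "codazzi N g D'" by (rule codazzi_dual[OF N(2-6)])
  have "codazzi M (induced_metric N g) C"
    by (rule codazzi_induced[OF M N(1,2,3,4) assms(4,6,8)])
  moreover have "codazzi M (induced_metric N g) C'"
    by (rule codazzi_induced[OF M N(1,2,5) D' assms(4,7,9)])
  moreover have "dual_connection M (induced_metric N g) C C'"
    by (rule dual_connection_induced[OF M N(1,2,3,5,6) assms(4,6,8,7,9)])
  ultimately show ?thesis using assms(2) by (simp add: lightlike_statistical_submanifold_def)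
qed

end
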